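(* Suppose that $u_1, u_2 : M \to N$ are two smooth maps between manifolds and that $h : M \times [0,1] \to N$ is a smooth homotopy between them. Then $u_1$ and $u_2$ are constant rank signature equivalent.
   Context: Manifolds are smooth manifolds; phase spaces $C$ with boundary, such as $M \times [0,1]$, are allowed. A smooth map has constant rank if its Jacobian has the same rank at every point of the domain. Smooth maps $u_1: M_1 \to N$ and $u_2: M_2 \to N$ are constant rank signature equivalent if there exist a manifold $C$, a smooth map $U: C \to N$, and smooth constant rank maps $\phi_1: M_1 \to C$ and $\phi_2: M_2 \to C$ such that $u_1 = U \circ \phi_1$ and $u_2 = U \circ \phi_2$. *)

theory Defs
  imports "HOL-Analysis.Analysis" "Jordan_Normal_Form.DL_Rank"
begin

section \<open>Smooth functions on subsets of Euclidean space\<close>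

text \<open>
  Dimensions of manifolds are quantified over below, so points of $n$-space are the sequences in
  the topological space \<^const>\<open>Euclidean_space\<close>, that is, sequences vanishing from index $n$ on.
\<close>

type_synonym rvec = "nat \<Rightarrow> real"

definition half_space :: "nat \<Rightarrow> rvec topology" where
  "half_space n = subtopology (Euclidean_space n) {x. 0 \<le> x (n - 1)}"

text \<open>
  The derivative is taken within the slice of \<open>S\<close> through \<open>x\<close>, which makes it one-sided at
  boundary points of a relatively open subset of a half space.
\<close>

definition partial_deriv :: "rvec set \<Rightarrow> nat \<Rightarrow> (rvec \<Rightarrow> real) \<Rightarrow> rvec \<Rightarrow> real" where
  "partial_deriv S i f x =
     vector_derivative (\<lambda>t. f (x(i := t))) (at (x i) within {t. x(i := t) \<in> S})"

primrec Ck_on :: "nat \<Rightarrow> nat \<Rightarrow> rvec set \<Rightarrow> (rvec \<Rightarrow> real) \<Rightarrow> bool" where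
  "Ck_on n 0 W f \<longleftrightarrow> continuous_map (subtopology (Euclidean_space n) W) euclideanreal f"
| "Ck_on n (Suc k) W f \<longleftrightarrow>
     continuous_map (subtopology (Euclidean_space n) W) euclideanreal f \<and>
     (\<forall>i<n. (\<forall>x\<in>W. (\<lambda>t. f (x(i := t))) differentiable (at (x i) within {t. x(i := t) \<in> W})) \<and>
            Ck_on n k W (partial_deriv W i f))"

text \<open>
  On a set that need not be open, smoothness means having local smooth extensions to open subsets
  of $n$-space.
\<close>

definition smooth_on :: "nat \<Rightarrow> rvec set \<Rightarrow> (rvec \<Rightarrow> real) \<Rightarrow> bool" where
  "smooth_on n S f \<longleftrightarrow>
     (\<forall>x\<in>S. \<exists>W g. openin (Euclidean_space n) W \<and> x \<in> W \<and> (\<forall>k. Ck_on n k W g) \<and>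
                  (\<forall>y\<in>S \<inter> W. g y = f y))"

definition smooth_vec_on :: "nat \<Rightarrow> nat \<Rightarrow> rvec set \<Rightarrow> (rvec \<Rightarrow> rvec) \<Rightarrow> bool" where
  "smooth_vec_on m n S F \<longleftrightarrow> (\<forall>j<n. smooth_on m S (\<lambda>x. F x j))"

definition jacobian :: "nat \<Rightarrow> nat \<Rightarrow> rvec set \<Rightarrow> (rvec \<Rightarrow> rvec) \<Rightarrow> rvec \<Rightarrow> real mat" where
  "jacobian m n S F x = mat n m (\<lambda>(j, i). partial_deriv S i (\<lambda>y. F y j) x)"


section \<open>Smooth manifolds\<close>

text \<open>
  The smooth structure is the one generated by the given atlas, which need not be maximal. A chart
  is a coordinate function together with its domain; the values of the coordinate function outside
  the domain are irrelevant.
\<close>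

record 'a mfd =
  mfd_top :: "'a topology"
  mfd_dim :: nat
  mfd_charts :: "('a set \<times> ('a \<Rightarrow> rvec)) set"

abbreviation mfd_points :: "'a mfd \<Rightarrow> 'a set" where
  "mfd_points M \<equiv> topspace (mfd_top M)"

definition chart_into :: "'a topology \<Rightarrow> rvec topology \<Rightarrow> 'a set \<times> ('a \<Rightarrow> rvec) \<Rightarrow> bool" where
  "chart_into X E = (\<lambda>(U, \<phi>). openin X U \<and> openin E (\<phi> ` U) \<and>
     homeomorphic_map (subtopology X U) (subtopology E (\<phi> ` U)) \<phi>)"

definition smooth_atlas :: "'a mfd \<Rightarrow> bool" where
  "smooth_atlas M \<longleftrightarrow>
     (\<Union>(U, \<phi>)\<in>mfd_charts M. U) = mfd_points M \<and>
     (\<forall>(U, \<phi>)\<in>mfd_charts M. \<forall>(V, \<psi>)\<in>mfd_charts M.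
        smooth_vec_on (mfd_dim M) (mfd_dim M) (\<phi> ` (U \<inter> V)) (\<psi> \<circ> inv_into U \<phi>))"

definition smooth_manifold :: "'a mfd \<Rightarrow> bool" where
  "smooth_manifold M \<longleftrightarrow>
     Hausdorff_space (mfd_top M) \<and> second_countable (mfd_top M) \<and> smooth_atlas M \<and>
     (\<forall>c\<in>mfd_charts M. chart_into (mfd_top M) (Euclidean_space (mfd_dim M)) c)"

text \<open>The boundary may be empty: charts onto open subsets of the full space are allowed.\<close>

definition smooth_manifold_with_boundary :: "'a mfd \<Rightarrow> bool" where
  "smooth_manifold_with_boundary M \<longleftrightarrow>
     Hausdorff_space (mfd_top M) \<and> second_countable (mfd_top M) \<and> smooth_atlas M \<and>
     (\<forall>c\<in>mfd_charts M. chart_into (mfd_top M) (Euclidean_space (mfd_dim M)) c \<or>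
                        chart_into (mfd_top M) (half_space (mfd_dim M)) c)"

definition smooth_map :: "'a mfd \<Rightarrow> 'b mfd \<Rightarrow> ('a \<Rightarrow> 'b) \<Rightarrow> bool" where
  "smooth_map M N f \<longleftrightarrow>
     continuous_map (mfd_top M) (mfd_top N) f \<and>
     (\<forall>(U, \<phi>)\<in>mfd_charts M. \<forall>(V, \<psi>)\<in>mfd_charts N.
        smooth_vec_on (mfd_dim M) (mfd_dim N) (\<phi> ` (U \<inter> f -` V)) (\<psi> \<circ> f \<circ> inv_into U \<phi>))"

definition constant_rank :: "'a mfd \<Rightarrow> 'b mfd \<Rightarrow> ('a \<Rightarrow> 'b) \<Rightarrow> bool" where
  "constant_rank M N f \<longleftrightarrow>
     (\<exists>r. \<forall>(U, \<phi>)\<in>mfd_charts M. \<forall>(V, \<psi>)\<in>mfd_charts N. \<forall>p\<in>U \<inter> f -` V.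
        vec_space.rank (mfd_dim N)
          (jacobian (mfd_dim M) (mfd_dim N) (\<phi> ` (U \<inter> f -` V)) (\<psi> \<circ> f \<circ> inv_into U \<phi>) (\<phi> p)) = r)"


section \<open>Homotopies\<close>

text \<open>
  The coordinates of the second factor come last, so that with \<^const>\<open>half_space\<close> constraining the
  last coordinate the product of a manifold without boundary and one with boundary is again a
  manifold with boundary.
\<close>

definition prod_mfd :: "'a mfd \<Rightarrow> 'b mfd \<Rightarrow> ('a \<times> 'b) mfd" where
  "prod_mfd M N =
     \<lparr>mfd_top = prod_topology (mfd_top M) (mfd_top N),
      mfd_dim = mfd_dim M + mfd_dim N,
      mfd_charts = {(U \<times> V, \<lambda>(p, q) i. if i < mfd_dim M then \<phi> p i else \<psi> q (i - mfd_dim M))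
                    | U \<phi> V \<psi>. (U, \<phi>) \<in> mfd_charts M \<and> (V, \<psi>) \<in> mfd_charts N}\<rparr>"

definition unit_interval_mfd :: "real mfd" where
  "unit_interval_mfd =
     \<lparr>mfd_top = top_of_set {0..1},
      mfd_dim = 1,
      mfd_charts = {({0..<1}, \<lambda>t i. if i = 0 then t else 0),
                    ({0<..1}, \<lambda>t i. if i = 0 then 1 - t else 0)}\<rparr>"

definition smooth_homotopy ::
    "'a mfd \<Rightarrow> 'b mfd \<Rightarrow> ('a \<times> real \<Rightarrow> 'b) \<Rightarrow> ('a \<Rightarrow> 'b) \<Rightarrow> ('a \<Rightarrow> 'b) \<Rightarrow> bool" where
  "smooth_homotopy M N h u1 u2 \<longleftrightarrow>
     smooth_map (prod_mfd M unit_interval_mfd) N h \<and>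
     (\<forall>p\<in>mfd_points M. h (p, 0) = u1 p \<and> h (p, 1) = u2 p)"


section \<open>Constant rank signature equivalence\<close>

text \<open>
  The points of the phase space \<open>C\<close> are taken from a fixed type, as HOL does not quantify over
  types inside a formula. Any type of cardinality at least the continuum gives the same notion up
  to diffeomorphism: a second countable Hausdorff space has at most continuum many points, and a
  smooth structure can be transported along an injection.
\<close>

definition constant_rank_signature_equivalent ::
    "'a mfd \<Rightarrow> 'b mfd \<Rightarrow> 'c mfd \<Rightarrow> ('a \<Rightarrow> 'c) \<Rightarrow> ('b \<Rightarrow> 'c) \<Rightarrow> bool" where
  "constant_rank_signature_equivalent M\<^sub>1 M\<^sub>2 N u\<^sub>1 u\<^sub>2 \<longleftrightarrow>
     (\<exists>(C :: rvec mfd) U \<phi>\<^sub>1 \<phi>\<^sub>2.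
        smooth_manifold_with_boundary C \<and> smooth_map C N U \<and>
        smooth_map M\<^sub>1 C \<phi>\<^sub>1 \<and> constant_rank M\<^sub>1 C \<phi>\<^sub>1 \<and>
        smooth_map M\<^sub>2 C \<phi>\<^sub>2 \<and> constant_rank M\<^sub>2 C \<phi>\<^sub>2 \<and>
        (\<forall>p\<in>mfd_points M\<^sub>1. u\<^sub>1 p = U (\<phi>\<^sub>1 p)) \<and>
        (\<forall>p\<in>mfd_points M\<^sub>2. u\<^sub>2 p = U (\<phi>\<^sub>2 p)))"

end

theory Submission
  imports Defs
begin

text \<open>
  The phase space is the cylinder $M \times [0,1]$ with \<open>h\<close> as the map to \<open>N\<close>, and the two maps
  into it are the inclusions of the ends. In charts such an inclusion is a transition map of
  \<open>M\<close> followed by constants; the chain rule makes the Jacobian of a transition map invertible, so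
  the rank is constantly the dimension of \<open>M\<close>. As phase spaces live on sequences of reals, the cylinder is
  transported there along an injection, which exists because it is Hausdorff and second countable.
\<close>

section \<open>Calculus on open subsets of Euclidean space\<close>

text \<open>The geometry is short; the work lies in making it computable in charts. The dimension is
  a variable, so points are sequences in a bare topological space, and all calculus goes through
  partial derivatives along coordinate slices. The rank demands one genuine chain rule, for a
  transition map and its inverse. Elsewhere smooth functions are composed only with coordinate
  projections, which act directly on slices, or have the same coordinate expression as a function
  already known to be smooth. The ends of the cylinder lie in its boundary, where derivatives are
  one-sided. The Jacobians of the inclusions, however, are taken on the source \<open>M\<close>,
  whose coordinate domains are open, so the rank computation sees two-sided derivatives only. The
  rank is defined chart by chart over an atlas that need not be maximal. Constancy therefore has to
  hold for every pair of charts, and the left inverse yields the same value for each.\<close>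

lemma open_slice:
  assumes "openin (Euclidean_space n) W" "i < n" "x \<in> topspace (Euclidean_space n)"
  shows "open {t. x(i := t) \<in> W}"
proof -
  have "continuous_map euclideanreal (powertop_real UNIV) (\<lambda>t. x(i := t))"
    unfolding continuous_map_componentwise_UNIV
  proof
    show "continuous_map euclideanreal euclideanreal (\<lambda>t. (x(i := t)) k)" for k
      by (cases "k = i") simp_all
  qed
  moreover have "(\<lambda>t. x(i := t)) \<in> topspace euclideanreal \<rightarrow> {x. \<forall>i\<ge>n. x i = 0}"
    using assms(2,3) unfolding topspace_Euclidean_space by force
  ultimately have "continuous_map euclideanreal (Euclidean_space n) (\<lambda>t. x(i := t))"
    unfolding Euclidean_space_def by (rule continuous_map_into_subtopology)
  from openin_continuous_map_preimage[OF this assms(1)] show ?thesis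
    by simp
qed

lemma partial_deriv_cong:
  assumes "x \<in> S" "\<And>y. y \<in> S \<Longrightarrow> f y = g y"
  shows "partial_deriv S i f x = partial_deriv S i g x"
  unfolding partial_deriv_def using assms by (intro vector_derivative_cong_eq) auto

text \<open>The slice through a point of an open set is open, so the derivative in
  \<open>partial_deriv\<close> is two-sided there.\<close>

lemma at_within_slice:
  assumes "openin (Euclidean_space n) W" "i < n" "x \<in> W"
  shows "at (x i) within {t. x(i := t) \<in> W} = at (x i)"
  using assms open_slice[OF assms(1,2)] openin_subset[OF assms(1)]
  by (intro at_within_open) auto

text \<open>Smoothness provides local extensions only. This lemma carries the partial derivatives of
  an extension \<open>g\<close> on \<open>W\<close> back to the function \<open>f\<close> on
  \<open>S\<close> that enters a Jacobian.\<close>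

lemma partial_deriv_local:
  assumes S: "openin (Euclidean_space n) S" and W: "openin (Euclidean_space n) W"
    and x: "x \<in> S" "x \<in> W" and "i < n" and eq: "\<And>y. y \<in> S \<inter> W \<Longrightarrow> f y = g y"
  shows "partial_deriv S i f x = partial_deriv W i g x"
proof -
  have SW: "openin (Euclidean_space n) (S \<inter> W)"
    using S W by blast
  have "open {t. x(i := t) \<in> S \<inter> W}"
    using open_slice[OF SW \<open>i < n\<close>] openin_subset[OF S] x by blast
  then have "\<forall>\<^sub>F t in nhds (x i). t \<in> UNIV \<longrightarrow> f (x(i := t)) = g (x(i := t))"
    unfolding eventually_nhds using x eq by (intro exI[of _ "{t. x(i := t) \<in> S \<inter> W}"]) auto
  then have "vector_derivative (\<lambda>t. f (x(i := t))) (at (x i)) =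
      vector_derivative (\<lambda>t. g (x(i := t))) (at (x i))"
    by (intro vector_derivative_cong_eq) auto
  then show ?thesis
    unfolding partial_deriv_def
    using at_within_slice[OF S \<open>i < n\<close> x(1)] at_within_slice[OF W \<open>i < n\<close> x(2)] by simp
qed

section \<open>Functions of class C^k: locality and first examples\<close>

lemma Ck_on_imp_continuous:
  "Ck_on n k W f \<Longrightarrow> continuous_map (subtopology (Euclidean_space n) W) euclideanreal f"
  by (cases k) auto

lemma Ck_on_cong:
  assumes "Ck_on n k W f" "\<And>x. x \<in> W \<Longrightarrow> f x = g x"
  shows "Ck_on n k W g"
  using assms
proof (induction k arbitrary: f g)
  case 0
  then show ?case
    by (auto intro: continuous_map_eq)
next
  case (Suc k)
  have "(\<lambda>t. g (x(i := t))) differentiable (at (x i) within {t. x(i := t) \<in> W})"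
    if "i < n" "x \<in> W" for i x
  proof -
    have "(\<lambda>t. f (x(i := t))) differentiable (at (x i) within {t. x(i := t) \<in> W})"
      using Suc.prems that by auto
    then show ?thesis
      \<comment> \<open>The two functions agree on the whole slice, so any positive radius
        serves.\<close>
      by (rule differentiable_transform_within[where d = 1]) (use Suc.prems(2) that(2) in simp_all)
  qed
  moreover have "Ck_on n k W (partial_deriv W i g)" if "i < n" for i
    by (rule Suc.IH[of "partial_deriv W i f"])
      (use Suc.prems(1) that partial_deriv_cong[OF _ Suc.prems(2)] in simp_all)
  ultimately show ?case
    using continuous_map_eq[OF Ck_on_imp_continuous[OF Suc.prems(1)], of g] Suc.prems(2) by simp
qed

lemma continuous_map_Euclidean_coordinate:
  "continuous_map (subtopology (Euclidean_space n) W) euclideanreal (\<lambda>x. x j)"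
  unfolding Euclidean_space_def
  by (intro continuous_map_from_subtopology continuous_map_product_projection) auto

lemma Ck_on_const:
  assumes "openin (Euclidean_space n) W"
  shows "Ck_on n k W (\<lambda>_. c)"
proof (induction k arbitrary: c)
  case (Suc k)
  have "Ck_on n k W (partial_deriv W i (\<lambda>_. c))" if "i < n" for i
    by (rule Ck_on_cong[OF Suc.IH[of 0]])
      (simp add: partial_deriv_def at_within_slice[OF assms that])
  then show ?case by simp
qed simp

text \<open>One shape covers the constant coordinates of a slice of a product (\<open>c = 0\<close>)
  and the transition maps of the unit interval. All partial derivatives are constants, which reduces
  the claim to \<open>Ck_on_const\<close>.\<close>

lemma Ck_on_affine_coordinate:
  assumes W: "openin (Euclidean_space n) W"
  shows "Ck_on n k W (\<lambda>x. b + c * x j)"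
proof -
  have cont: "continuous_map (subtopology (Euclidean_space n) W) euclideanreal (\<lambda>x. b + c * x j)"
    by (intro continuous_map_add continuous_map_real_mult continuous_map_Euclidean_coordinate) auto
  show ?thesis
  proof (cases k)
    case 0
    then show ?thesis
      by (simp add: cont)
  next
    case (Suc l)
    have deriv: "((\<lambda>t. b + c * (x(i := t)) j) has_vector_derivative (if i = j then c else 0)) (at (x i))"
      for i and x :: rvec
      unfolding has_real_derivative_iff_has_vector_derivative[symmetric]
      by (auto intro!: derivative_eq_intros)
    have "Ck_on n l W (partial_deriv W i (\<lambda>x. b + c * x j))" if "i < n" for i
      by (rule Ck_on_cong[OF Ck_on_const[OF W, of l "if i = j then c else 0"]])
        (simp only: partial_deriv_def at_within_slice[OF W that] vector_derivative_at[OF deriv])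
    moreover have "(\<lambda>t. b + c * (x(i := t)) j) differentiable (at (x i) within S)" for i S and x :: rvec
      using deriv[of x i] by (meson differentiableI_vector differentiable_at_withinI)
    ultimately show ?thesis
      unfolding Suc Ck_on.simps
      using cont by blast
  qed
qed

text \<open>Boxes take the place of balls. All points vanish from index \<open>n\<close> on, so only
  finitely many coordinates can leave a basic open set, and the least of their radii works for all
  of them.\<close>

lemma openin_Euclidean_space_contains_box:
  assumes W: "openin (Euclidean_space n) W" and y: "y \<in> W"
  obtains \<delta> where "\<delta> > 0"
    "\<And>x. x \<in> topspace (Euclidean_space n) \<Longrightarrow> (\<And>j. j < n \<Longrightarrow> \<bar>x j - y j\<bar> < \<delta>) \<Longrightarrow> x \<in> W"
proof -
  obtain T where T: "openin (powertop_real UNIV) T" and WT: "W = T \<inter> topspace (Euclidean_space n)"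
    using W unfolding Euclidean_space_def openin_subtopology by auto
  have "y \<in> T"
    using y WT by blast
  from product_topology_open_contains_basis[OF T this]
  obtain X where "y \<in> Pi\<^sub>E UNIV X \<and> (\<forall>i. openin euclideanreal (X i)) \<and>
      finite {i. X i \<noteq> topspace euclideanreal} \<and> Pi\<^sub>E UNIV X \<subseteq> T" ..
  then have X: "y \<in> Pi\<^sub>E UNIV X" "Pi\<^sub>E UNIV X \<subseteq> T" and X_open: "\<And>i. open (X i)"
    using open_openin by simp_all
  have "\<forall>i. \<exists>e>0. \<forall>s. \<bar>s - y i\<bar> < e \<longrightarrow> s \<in> X i"
  proof
    fix i
    have "y i \<in> X i"
      using X(1) by auto
    then show "\<exists>e>0. \<forall>s. \<bar>s - y i\<bar> < e \<longrightarrow> s \<in> X i"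
      using X_open[of i] unfolding open_dist dist_real_def by blast
  qed
  then obtain e where e: "\<And>i. e i > 0" "\<And>i s. \<bar>s - y i\<bar> < e i \<Longrightarrow> s \<in> X i"
    by metis
  \<comment> \<open>The 1 keeps the set nonempty when \<open>n = 0\<close>.\<close>
  define \<delta> where "\<delta> = Min (insert 1 (e ` {..<n}))"
  have "\<delta> > 0"
    unfolding \<delta>_def using e(1) by auto
  moreover have "x \<in> W" if x: "x \<in> topspace (Euclidean_space n)" "\<And>j. j < n \<Longrightarrow> \<bar>x j - y j\<bar> < \<delta>" for x
  proof -
    have "\<delta> \<le> e j" if "j < n" for j
      unfolding \<delta>_def using that by (intro Min_le) auto
    then have "x j \<in> X j" if "j < n" for j
      using that x(2)[OF that] e(2) by (meson less_le_trans)
    moreover have "x j \<in> X j" if "j \<ge> n" for j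
    proof -
      have "x j = y j"
        using that x(1) y WT by (auto simp: topspace_Euclidean_space)
      then show ?thesis
        using X(1) by (auto simp: PiE_iff)
    qed
    ultimately have "x j \<in> X j" for j
      by (meson not_le)
    then have "x \<in> Pi\<^sub>E UNIV X"
      by (simp add: PiE_UNIV_domain)
    then show ?thesis
      using X(2) WT x(1) by auto
  qed
  ultimately show ?thesis
    by (rule that)
qed

text \<open>By the mean value theorem the difference quotient is a value of the partial derivative
  on the segment, so it inherits the bound. A \<open>closed_segment\<close> is used because a
  coordinate of a curve may move either way, and the quotient is symmetric in its end
  points.\<close>

lemma difference_quotient_near_partial_deriv:
  assumes W: "openin (Euclidean_space n) W" and g: "Ck_on n (Suc 0) W g" and j: "j < n"
    and seg: "\<And>s. s \<in> closed_segment a b \<Longrightarrow> z(j := s) \<in> W"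
    and near: "\<And>s. s \<in> closed_segment a b \<Longrightarrow> \<bar>partial_deriv W j g (z(j := s)) - D\<bar> < \<epsilon>"
    and "a \<noteq> b"
  shows "\<bar>(g (z(j := b)) - g (z(j := a))) / (b - a) - D\<bar> < \<epsilon>"
proof -
  define q where "q s = g (z(j := s))" for s
  have deriv: "(q has_real_derivative partial_deriv W j g (z(j := s))) (at s)"
    if "s \<in> closed_segment a b" for s
  proof -
    \<comment> \<open>With \<open>w\<close> as base point the derivative is taken at
      \<open>w j = s\<close>, while the slice through \<open>w\<close> is still the slice through
      \<open>z\<close>.\<close>
    define w where "w = z(j := s)"
    have w: "w \<in> W" "w j = s" "\<And>t. w(j := t) = z(j := t)"
      using seg[OF that] by (auto simp: w_def)
    have "(\<lambda>t. g (w(j := t))) differentiable (at (w j) within {t. w(j := t) \<in> W})"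
      using g j w(1) by auto
    then have "q differentiable (at s)"
      unfolding at_within_slice[OF W j w(1)] by (simp add: w(2,3) q_def[abs_def])
    then show ?thesis
      unfolding has_real_derivative_iff_has_vector_derivative
      using vector_derivative_works[of q "at s"] at_within_slice[OF W j w(1)] w
      unfolding partial_deriv_def w_def[symmetric] q_def by simp
  qed
  have main: "\<exists>s\<in>closed_segment a b. q d - q c = (d - c) * partial_deriv W j g (z(j := s))"
    if "c < d" "{c..d} = closed_segment a b" for c d
    using MVT2[OF that(1), of q "\<lambda>s. partial_deriv W j g (z(j := s))"] deriv that(2)
    by (metis atLeastAtMost_iff less_imp_le)
  have "\<exists>s\<in>closed_segment a b. q b - q a = (b - a) * partial_deriv W j g (z(j := s))"
  proof (cases "a < b")
    case True
    then show ?thesis using main[of a b] by (simp add: closed_segment_eq_real_ivl)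
  next
    case False
    then obtain s where "s\<in>closed_segment a b" "q a - q b = (a - b) * partial_deriv W j g (z(j := s))"
      using main[of b a] \<open>a \<noteq> b\<close> by (auto simp: closed_segment_eq_real_ivl)
    then show ?thesis by (intro bexI[of _ s]) (auto simp: algebra_simps)
  qed
  then obtain s where "s\<in>closed_segment a b" "(q b - q a) / (b - a) = partial_deriv W j g (z(j := s))"
    using \<open>a \<noteq> b\<close> by auto
  then show ?thesis
    using near[of s] by (simp add: q_def)
qed

text \<open>
  The increment of \<open>g\<close> is telescoped along the path that changes one coordinate at a time; the mean
  value theorem and continuity of the partial derivatives identify the limit of each difference
  quotient.
\<close>

lemma chain_rule_along_curve:
  fixes \<gamma> :: "real \<Rightarrow> rvec"
  assumes W: "openin (Euclidean_space n) W" and g: "Ck_on n (Suc 0) W g" and y: "\<gamma> a \<in> W"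
    and \<gamma>: "\<forall>\<^sub>F t in at a. \<gamma> t \<in> topspace (Euclidean_space n)"
    and d: "\<And>j. j < n \<Longrightarrow> ((\<lambda>t. \<gamma> t j) has_real_derivative d j) (at a)"
  shows "((\<lambda>t. g (\<gamma> t)) has_real_derivative (\<Sum>j<n. partial_deriv W j g (\<gamma> a) * d j)) (at a)"
proof -
  define y where "y = \<gamma> a"
  have yW: "y \<in> W" using y by (simp add: y_def)
  have yE: "y \<in> topspace (Euclidean_space n)"
    using yW openin_subset[OF W] by auto
  define z where "z x k = (\<lambda>j. if j < k then x j else y j)" for x :: rvec and k
  \<comment> \<open>The default value where \<open>x j = y j\<close> is the expected limit. The
    curve may return to \<open>y j\<close> in this coordinate, and with this choice both the
    telescoping identity and the limit of \<open>q\<close> survive there.\<close>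
  define q where "q j x = (if x j = y j then partial_deriv W j g y
      else (g (z x (Suc j)) - g (z x j)) / (x j - y j))" for j x
  have z_upd: "(z x j)(j := x j) = z x (Suc j)" "(z x j)(j := y j) = z x j" for x j
    by (auto simp: z_def fun_eq_iff less_Suc_eq)
  have telescope: "g x - g y = (\<Sum>j<n. q j x * (x j - y j))" if "x \<in> topspace (Euclidean_space n)" for x
  proof -
    have "q j x * (x j - y j) = g (z x (Suc j)) - g (z x j)" for j
    proof (cases "x j = y j")
      case True
      then show ?thesis
        using z_upd[of x j] by simp
    qed (simp add: q_def)
    then have "(\<Sum>j<n. q j x * (x j - y j)) = g (z x n) - g (z x 0)"
      by (simp add: sum_lessThan_telescope[of "\<lambda>k. g (z x k)" n])
    moreover have "z x n = x" "z x 0 = y"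
      using that yE by (auto simp: z_def fun_eq_iff topspace_Euclidean_space not_less)
    ultimately show ?thesis by simp
  qed
  have cont: "\<forall>\<^sub>F t in at a. \<bar>\<gamma> t j - y j\<bar> < \<delta>" if "j < n" "\<delta> > 0" for j \<delta>
  proof -
    have "((\<lambda>t. \<gamma> t j) \<longlongrightarrow> y j) (at a)"
      using DERIV_isCont[OF d[OF that(1)]] by (simp add: isCont_def y_def)
    then show ?thesis
      using that(2) by (auto simp: tendsto_iff dist_real_def)
  qed
  have q_lim: "((\<lambda>t. q j (\<gamma> t)) \<longlongrightarrow> partial_deriv W j g y) (at a)" if j: "j < n" for j
  proof (rule tendstoI)
    fix \<epsilon> :: real assume "\<epsilon> > 0"
    have "continuous_map (subtopology (Euclidean_space n) W) euclideanreal (partial_deriv W j g)"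
      using g j by simp
    then have "openin (subtopology (Euclidean_space n) W)
        {x \<in> topspace (subtopology (Euclidean_space n) W).
          partial_deriv W j g x \<in> ball (partial_deriv W j g y) \<epsilon>}"
      by (rule openin_continuous_map_preimage) auto
    then have "openin (Euclidean_space n) {x \<in> topspace (subtopology (Euclidean_space n) W).
          partial_deriv W j g x \<in> ball (partial_deriv W j g y) \<epsilon>}"
      using W openin_open_subtopology by blast
    then obtain \<delta> where "\<delta> > 0" and \<delta>: "\<And>x. x \<in> topspace (Euclidean_space n) \<Longrightarrow>
        (\<And>i. i < n \<Longrightarrow> \<bar>x i - y i\<bar> < \<delta>) \<Longrightarrow> x \<in> W \<and> \<bar>partial_deriv W j g x - partial_deriv W j g y\<bar> < \<epsilon>"
      by (rule openin_Euclidean_space_contains_box[where y = y])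
        (use yW yE \<open>\<epsilon> > 0\<close> in \<open>auto simp: dist_real_def abs_minus_commute\<close>)
    have "\<forall>\<^sub>F t in at a. \<forall>i\<in>{..<n}. \<bar>\<gamma> t i - y i\<bar> < \<delta>"
      by (rule eventually_ball_finite) (use cont \<open>\<delta> > 0\<close> in auto)
    with \<gamma> show "\<forall>\<^sub>F t in at a. dist (q j (\<gamma> t)) (partial_deriv W j g y) < \<epsilon>"
    proof eventually_elim
      case (elim t)
      show ?case
      proof (cases "\<gamma> t j = y j")
        case False
        \<comment> \<open>Each coordinate of this point is one of \<open>\<gamma> t\<close>, one of
          \<open>y\<close>, or lies between the two, so it stays in the box around \<open>y\<close>
          as soon as \<open>\<gamma> t\<close> does.\<close>
        have seg: "(z (\<gamma> t) j)(j := s) \<in> W \<and>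
            \<bar>partial_deriv W j g ((z (\<gamma> t) j)(j := s)) - partial_deriv W j g y\<bar> < \<epsilon>"
          if "s \<in> closed_segment (y j) (\<gamma> t j)" for s
        proof (rule \<delta>)
          show "(z (\<gamma> t) j)(j := s) \<in> topspace (Euclidean_space n)"
            using elim(1) yE j by (auto simp: topspace_Euclidean_space z_def)
          have "\<bar>s - y j\<bar> < \<delta>"
            using that bspec[OF elim(2), of j] j by (auto simp: closed_segment_eq_real_ivl split: if_splits)
          then show "\<bar>((z (\<gamma> t) j)(j := s)) i - y i\<bar> < \<delta>" if "i < n" for i
            using that elim(2) \<open>\<delta> > 0\<close> by (auto simp: z_def)
        qed
        have "\<bar>(g ((z (\<gamma> t) j)(j := \<gamma> t j)) - g ((z (\<gamma> t) j)(j := y j))) / (\<gamma> t j - y j)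
            - partial_deriv W j g y\<bar> < \<epsilon>"
          by (rule difference_quotient_near_partial_deriv[OF W g j]) (use seg False in auto)
        then show ?thesis
          using False by (simp add: q_def dist_real_def z_upd)
      qed (simp add: q_def \<open>\<epsilon> > 0\<close>)
    qed
  qed
  have "((\<lambda>t. \<Sum>j<n. q j (\<gamma> t) * ((\<gamma> t j - y j) / (t - a))) \<longlongrightarrow> (\<Sum>j<n. partial_deriv W j g y * d j)) (at a)"
    using d unfolding has_field_derivative_iff y_def[symmetric]
    by (intro tendsto_sum tendsto_mult q_lim) auto
  moreover have "\<forall>\<^sub>F t in at a. (\<Sum>j<n. q j (\<gamma> t) * ((\<gamma> t j - y j) / (t - a))) = (g (\<gamma> t) - g y) / (t - a)"
    using \<gamma> by eventually_elim (simp only: telescope sum_divide_distrib times_divide_eq_right)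
  ultimately have "((\<lambda>t. (g (\<gamma> t) - g y) / (t - a)) \<longlongrightarrow> (\<Sum>j<n. partial_deriv W j g y * d j)) (at a)"
    by (rule Lim_transform_eventually)
  then show ?thesis
    by (simp add: has_field_derivative_iff y_def)
qed

section \<open>Linear algebra\<close>

text \<open>\<open>B\<close> maps the columns of \<open>A\<close> to the unit vectors and forces the
  kernel of \<open>A\<close> to be trivial. Distinctness is shown separately because linear
  independence is a property of the set of columns, in which repeated columns would be
  invisible.\<close>

lemma rank_left_invertible:
  fixes A B :: "'a :: field mat"
  assumes A: "A \<in> carrier_mat n nc" and B: "B \<in> carrier_mat nc n" and BA: "B * A = 1\<^sub>m nc"
  shows "vec_space.rank n A = nc"
proof -
  interpret vec_space "TYPE('a)" n .
  have "distinct (cols A)"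
    unfolding distinct_conv_nth
  proof (intro allI impI)
    fix i j assume ij: "i < length (cols A)" "j < length (cols A)" "i \<noteq> j"
    then have lt: "i < nc" "j < nc" using A by auto
    have "B *\<^sub>v col A k = unit_vec nc k" if "k < nc" for k
      using that col_mult2[OF B A that] by (simp add: BA)
    then have "col A i \<noteq> col A j"
      using ij(3) lt unit_vec_eq[OF lt(1)] by metis
    then show "cols A ! i \<noteq> cols A ! j"
      using ij by simp
  qed
  moreover have "lin_indpt (set (cols A))"
  proof
    assume "lin_dep (set (cols A))"
    from lin_depE[OF A this \<open>distinct (cols A)\<close>]
    obtain v where v: "v \<in> carrier_vec nc" "v \<noteq> 0\<^sub>v nc" "A *\<^sub>v v = 0\<^sub>v n" by blast
    have "v = (B * A) *\<^sub>v v"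
      using v(1) by (simp add: BA)
    also have "\<dots> = 0\<^sub>v nc"
      using B by (intro eq_vecI) (simp_all add: assoc_mult_mat_vec[OF B A v(1)] v(3))
    finally show False using v(2) by simp
  qed
  ultimately show ?thesis
    by (rule lin_indpt_full_rank[OF A])
qed

section \<open>Smooth functions\<close>

lemma smooth_onE:
  assumes "smooth_on n S f" "x \<in> S"
  obtains W g where "openin (Euclidean_space n) W" "x \<in> W" "\<forall>k. Ck_on n k W g"
    "\<forall>y\<in>S \<inter> W. g y = f y"
proof -
  from bspec[OF assms(1)[unfolded smooth_on_def] assms(2)]
  obtain W g where "openin (Euclidean_space n) W \<and> x \<in> W \<and> (\<forall>k. Ck_on n k W g) \<and>
      (\<forall>y\<in>S \<inter> W. g y = f y)"
    by (elim exE)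
  then show thesis
    by (intro that[of W g]) simp_all
qed

lemma smooth_on_cong:
  assumes "smooth_on n S f" "\<And>x. x \<in> S \<Longrightarrow> f x = g x"
  shows "smooth_on n S g"
  using assms unfolding smooth_on_def by (metis IntD1)

lemma smooth_vec_on_cong:
  assumes "smooth_vec_on m n S F" "\<And>x. x \<in> S \<Longrightarrow> F x = G x"
  shows "smooth_vec_on m n S G"
  unfolding smooth_vec_on_def
  by (metis assms smooth_on_cong smooth_vec_on_def)

lemma smooth_on_affine_coordinate:
  assumes "S \<subseteq> topspace (Euclidean_space n)"
  shows "smooth_on n S (\<lambda>x. b + c * x j)"
  unfolding smooth_on_def
proof
  fix x assume "x \<in> S"
  then show "\<exists>W g. openin (Euclidean_space n) W \<and> x \<in> W \<and> (\<forall>k. Ck_on n k W g) \<and>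
      (\<forall>y\<in>S \<inter> W. g y = b + c * y j)"
    using assms Ck_on_affine_coordinate[OF openin_topspace]
    by (intro exI[of _ "topspace (Euclidean_space n)"] exI[of _ "\<lambda>x. b + c * x j"]) auto
qed

text \<open>The coordinate form of the projections of a product: \<open>block 0 m\<close> and
  \<open>block m k\<close> split a point of \<open>Euclidean_space (m + k)\<close>. Padding with
  zeros makes the result a point of \<open>Euclidean_space k\<close>.\<close>

definition block :: "nat \<Rightarrow> nat \<Rightarrow> rvec \<Rightarrow> rvec" where
  "block a k x = (\<lambda>i. if i < k then x (a + i) else 0)"

lemma continuous_map_block: "continuous_map (Euclidean_space n) (Euclidean_space k) (block a k)"
  unfolding block_def continuous_map_componentwise_Euclidean_space
  using continuous_map_Euclidean_coordinate[of n UNIV] by simp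

lemma openin_block_preimage:
  assumes "openin (Euclidean_space k) W"
  shows "openin (Euclidean_space n) {x \<in> topspace (Euclidean_space n). block a k x \<in> W}"
  using openin_continuous_map_preimage[OF continuous_map_block assms] .

lemma block_upd:
  "block a k (x(i := t)) = (if a \<le> i \<and> i < a + k then (block a k x)(i - a := t) else block a k x)"
  by (auto simp: block_def fun_eq_iff)

text \<open>Changing one coordinate of \<open>x\<close> either changes one coordinate of its block
  or leaves the block fixed. A partial derivative of the composite is therefore again such a
  composite or 0, and the induction closes on functions of this form.\<close>

lemma Ck_on_block:
  assumes W: "openin (Euclidean_space k) W" and "Ck_on k l W f"
  shows "Ck_on n l {x \<in> topspace (Euclidean_space n). block a k x \<in> W} (\<lambda>x. f (block a k x))"
    (is "Ck_on n l ?V _")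
  using assms(2)
proof (induction l arbitrary: f)
  have V: "openin (Euclidean_space n) ?V"
    by (rule openin_block_preimage[OF W])
  have cont: "continuous_map (subtopology (Euclidean_space n) ?V) euclideanreal (\<lambda>x. f (block a k x))"
    if "continuous_map (subtopology (Euclidean_space k) W) euclideanreal f" for f
  proof -
    have "continuous_map (subtopology (Euclidean_space n) ?V) (subtopology (Euclidean_space k) W) (block a k)"
      by (intro continuous_map_into_subtopology continuous_map_from_subtopology continuous_map_block) auto
    from continuous_map_compose[OF this that] show ?thesis
      by (simp add: o_def)
  qed
  {
    case 0
    then show ?case by (simp add: cont)
  next
    case (Suc l)
    have *: "(\<lambda>t. f (block a k (x(i := t)))) differentiable (at (x i) within {t. x(i := t) \<in> ?V}) \<and>
        partial_deriv ?V i (\<lambda>x. f (block a k x)) x =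
          (if a \<le> i \<and> i < a + k then partial_deriv W (i - a) f (block a k x) else 0)"
      if i: "i < n" and x: "x \<in> ?V" for i x
    proof (cases "a \<le> i \<and> i < a + k")
      case True
      have xE: "x \<in> topspace (Euclidean_space n)" and xW: "block a k x \<in> W" using x by auto
      have upd: "block a k (x(i := t)) = (block a k x)(i - a := t)" for t
        using block_upd[of a k x i t] True by simp
      have "x(i := t) \<in> topspace (Euclidean_space n)" for t
        using xE i by (simp add: topspace_Euclidean_space)
      \<comment> \<open>Even the filters of the two derivatives coincide, so differentiability
        carries over literally.\<close>
      then have V_slice: "{t. x(i := t) \<in> ?V} = {t. (block a k x)(i - a := t) \<in> W}"
        by (simp only: mem_Collect_eq upd simp_thms)
      have xi: "x i = block a k x (i - a)"
        using True by (auto simp: block_def)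
      have "(\<lambda>t. f ((block a k x)(i - a := t))) differentiable
          (at (block a k x (i - a)) within {t. (block a k x)(i - a := t) \<in> W})"
        using Suc.prems True xW by (simp add: less_diff_conv2)
      then show ?thesis
        using True unfolding partial_deriv_def upd V_slice xi by simp
    next
      case False
      have "block a k (x(i := t)) = block a k x" for t
        using block_upd[of a k x i t] False by simp
      then show ?thesis
        unfolding partial_deriv_def at_within_slice[OF V i x] if_not_P[OF False] by simp
    qed
    have "Ck_on n l ?V (partial_deriv ?V i (\<lambda>x. f (block a k x)))" if i: "i < n" for i
    proof (cases "a \<le> i \<and> i < a + k")
      case True
      then have "i - a < k" by auto
      then have "Ck_on k l W (partial_deriv W (i - a) f)"
        using Suc.prems by simp
      from Suc.IH[OF this] show ?thesis
        by (rule Ck_on_cong) (use *[OF i] True in simp)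
    next
      case False
      show ?thesis
        by (rule Ck_on_cong[OF Ck_on_const[OF V, of l 0]]) (use *[OF i] False in simp)
    qed
    then show ?case
      using * cont[OF Ck_on_imp_continuous[OF Suc.prems]] by simp
  }
qed

lemma smooth_on_block:
  assumes f: "smooth_on k S f" and T: "T \<subseteq> topspace (Euclidean_space n)" "block a k ` T \<subseteq> S"
  shows "smooth_on n T (\<lambda>x. f (block a k x))"
  unfolding smooth_on_def
proof
  fix x assume x: "x \<in> T"
  then have "block a k x \<in> S"
    using T(2) by blast
  from smooth_onE[OF f this]
  obtain W g where W: "openin (Euclidean_space k) W" "block a k x \<in> W" "\<forall>l. Ck_on k l W g"
      "\<forall>y\<in>S \<inter> W. g y = f y" .
  let ?V = "{x \<in> topspace (Euclidean_space n). block a k x \<in> W}"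
  show "\<exists>W g. openin (Euclidean_space n) W \<and> x \<in> W \<and> (\<forall>k. Ck_on n k W g) \<and>
      (\<forall>y\<in>T \<inter> W. g y = f (block a k y))"
  proof (intro exI conjI allI ballI)
    show "openin (Euclidean_space n) ?V"
      by (rule openin_block_preimage[OF W(1)])
    show "x \<in> ?V"
      using x T W(2) by auto
    show "Ck_on n l ?V (\<lambda>x. g (block a k x))" for l
      by (rule Ck_on_block[OF W(1) spec[OF W(3)]])
    show "g (block a k y) = f (block a k y)" if "y \<in> T \<inter> ?V" for y
      using that T(2) W(4) by blast
  qed
qed

text \<open>A local extension has a two-sided derivative, and since \<open>S\<close> is open it
  agrees with \<open>f\<close> on a whole neighbourhood of \<open>x i\<close> in the slice.\<close>

lemma smooth_on_has_partial_deriv: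
  assumes f: "smooth_on n S f" and S: "openin (Euclidean_space n) S" and x: "x \<in> S" and i: "i < n"
  shows "((\<lambda>t. f (x(i := t))) has_real_derivative partial_deriv S i f x) (at (x i))"
proof -
  from smooth_onE[OF f x] obtain W g where W: "openin (Euclidean_space n) W" "x \<in> W"
      "\<forall>l. Ck_on n l W g" "\<forall>y\<in>S \<inter> W. g y = f y" .
  have "(\<lambda>t. g (x(i := t))) differentiable (at (x i) within {t. x(i := t) \<in> W})"
    using W(2) spec[OF W(3), of "Suc 0"] i by simp
  then have "((\<lambda>t. g (x(i := t))) has_real_derivative partial_deriv W i g x) (at (x i))"
    unfolding partial_deriv_def at_within_slice[OF W(1) i W(2)]
      has_real_derivative_iff_has_vector_derivative vector_derivative_works .
  also have "partial_deriv W i g x = partial_deriv S i f x"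
    by (rule partial_deriv_local[OF W(1) S W(2) x i]) (use W(4) in auto)
  finally show ?thesis
  proof (rule has_field_derivative_transform_within_open)
    have SW: "openin (Euclidean_space n) (S \<inter> W)"
      using S W(1) by blast
    show "open {t. x(i := t) \<in> S \<inter> W}"
      using open_slice[OF SW i] openin_subset[OF S] x by blast
  qed (use x W(2,4) in \<open>auto simp del: fun_upd_apply\<close>)
qed

lemma eventually_curve_in_open:
  fixes \<gamma> :: "real \<Rightarrow> rvec"
  assumes W: "openin (Euclidean_space n) W" and \<gamma>a: "\<gamma> a \<in> W"
    and \<gamma>: "\<forall>\<^sub>F t in at a. \<gamma> t \<in> topspace (Euclidean_space n)"
    and cont: "\<And>j. j < n \<Longrightarrow> isCont (\<lambda>t. \<gamma> t j) a"
  shows "\<forall>\<^sub>F t in at a. \<gamma> t \<in> W"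
proof -
  obtain \<delta> where \<delta>: "\<delta> > 0" "\<And>x. x \<in> topspace (Euclidean_space n) \<Longrightarrow>
      (\<And>j. j < n \<Longrightarrow> \<bar>x j - \<gamma> a j\<bar> < \<delta>) \<Longrightarrow> x \<in> W"
    using openin_Euclidean_space_contains_box[OF W \<gamma>a] by metis
  have "\<forall>\<^sub>F t in at a. \<forall>j\<in>{..<n}. \<bar>\<gamma> t j - \<gamma> a j\<bar> < \<delta>"
    using cont \<delta>(1) by (intro eventually_ball_finite) (auto simp: isCont_def tendsto_iff dist_real_def)
  with \<gamma> show ?thesis
    by eventually_elim (use \<delta>(2) in auto)
qed

text \<open>\<open>G\<close> stands for one coordinate of a left inverse of \<open>F\<close>.
  Differentiating \<open>G (F y) = y k\<close> along the \<open>i\<close>-th slice through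
  \<open>x\<close> gives one entry of the product of the two Jacobians.\<close>

lemma partial_derivs_left_inverse:
  assumes S: "openin (Euclidean_space m) S" and T: "openin (Euclidean_space n) T"
    and F: "smooth_vec_on m n S F" and FT: "F ` S \<subseteq> T" and G: "smooth_on n T G"
    and GF: "\<And>y. y \<in> S \<Longrightarrow> G (F y) = y k" and x: "x \<in> S" and i: "i < m"
  shows "(\<Sum>j<n. partial_deriv T j G (F x) * partial_deriv S i (\<lambda>y. F y j) x) = (if i = k then 1 else 0)"
proof -
  define \<gamma> where "\<gamma> t = F (x(i := t))" for t
  have \<gamma>x: "\<gamma> (x i) = F x" by (simp add: \<gamma>_def)
  have FxT: "F x \<in> T" using FT x by blast
  from smooth_onE[OF G FxT] obtain W g where W: "openin (Euclidean_space n) W" "F x \<in> W"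
      "\<forall>l. Ck_on n l W g" "\<forall>y\<in>T \<inter> W. g y = G y" .
  have d: "((\<lambda>t. \<gamma> t j) has_real_derivative partial_deriv S i (\<lambda>y. F y j) x) (at (x i))" if "j < n" for j
    using smooth_on_has_partial_deriv[OF _ S x i, of "\<lambda>y. F y j"] F that
    unfolding smooth_vec_on_def \<gamma>_def by blast
  have "open {t. x(i := t) \<in> S}"
    using open_slice[OF S i] openin_subset[OF S] x by blast
  then have slice: "\<forall>\<^sub>F t in at (x i). x(i := t) \<in> S"
    using x by (auto simp: eventually_at_topological)
  then have \<gamma>E: "\<forall>\<^sub>F t in at (x i). \<gamma> t \<in> topspace (Euclidean_space n)"
    by eventually_elim (use FT openin_subset[OF T] in \<open>auto simp: \<gamma>_def\<close>)
  have \<gamma>W: "\<forall>\<^sub>F t in at (x i). \<gamma> t \<in> W"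
    by (rule eventually_curve_in_open[where n = n]) (use W \<gamma>x \<gamma>E DERIV_isCont[OF d] in auto)
  \<comment> \<open>The chain rule is applied to the local extension \<open>g\<close>, which is
    known to be C^1 on the open set \<open>W\<close>; its partial derivatives are exchanged for
    those of \<open>G\<close> at the end.\<close>
  have deriv: "((\<lambda>t. g (\<gamma> t)) has_real_derivative
      (\<Sum>j<n. partial_deriv W j g (\<gamma> (x i)) * partial_deriv S i (\<lambda>y. F y j) x)) (at (x i))"
    by (rule chain_rule_along_curve[OF W(1) spec[OF W(3)] _ \<gamma>E d]) (simp_all add: \<gamma>x W(2))
  have deriv_id: "((\<lambda>t. (x(i := t)) k) has_real_derivative (if i = k then 1 else 0)) (at (x i))"
    by (auto intro!: derivative_eq_intros)
  have "\<forall>\<^sub>F t in at (x i). g (\<gamma> t) = (x(i := t)) k"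
    using slice \<gamma>W by eventually_elim (use W(4) GF FT in \<open>auto simp: \<gamma>_def simp del: fun_upd_apply\<close>)
  \<comment> \<open>Transfer of a derivative requires agreement at the base point as well, which the
    punctured filter does not give.\<close>
  then have ev: "\<forall>\<^sub>F t in nhds (x i). g (\<gamma> t) = (x(i := t)) k"
    unfolding eventually_nhds_conv_at
    using W(2,4) FT GF[OF x] x by (auto simp: \<gamma>x)
  have "(\<Sum>j<n. partial_deriv W j g (\<gamma> (x i)) * partial_deriv S i (\<lambda>y. F y j) x) =
      (if i = k then 1 else 0)"
    by (rule DERIV_unique[OF deriv DERIV_cong_ev[OF refl ev refl, THEN iffD2, OF deriv_id]])
  moreover have "partial_deriv W j g (F x) = partial_deriv T j G (F x)" if "j < n" for j
    by (rule partial_deriv_local[OF W(1) T W(2) _ that]) (use W(4) FT x in auto)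
  ultimately show ?thesis
    by (simp add: \<gamma>x)
qed

section \<open>Second countable spaces\<close>

lemma second_countable_euclidean:
  "second_countable (euclidean :: 'a :: second_countable_topology topology)"
proof -
  obtain \<B> :: "'a set set" where \<B>: "countable \<B>" "\<And>C. C \<in> \<B> \<Longrightarrow> open C"
      "\<And>S. open S \<Longrightarrow> \<exists>\<U>. \<U> \<subseteq> \<B> \<and> S = \<Union>\<U>"
    using univ_second_countable by blast
  show ?thesis
    unfolding second_countable_def
  proof (intro exI conjI ballI allI impI)
    fix U :: "'a set" and x assume "openin euclidean U \<and> x \<in> U"
    then obtain \<U> where "\<U> \<subseteq> \<B>" "U = \<Union>\<U>" "x \<in> \<Union>\<U>"
      using \<B>(3)[of U] by auto
    then show "\<exists>V\<in>\<B>. x \<in> V \<and> V \<subseteq> U"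
      by blast
  qed (use \<B> in auto)
qed

lemma second_countable_prod_topology:
  assumes "second_countable X" "second_countable Y"
  shows "second_countable (prod_topology X Y)"
proof -
  obtain \<A> where \<A>: "countable \<A>" "\<forall>V\<in>\<A>. openin X V"
      "\<forall>U x. openin X U \<and> x \<in> U \<longrightarrow> (\<exists>V\<in>\<A>. x \<in> V \<and> V \<subseteq> U)"
    using assms(1) unfolding second_countable_def by metis
  obtain \<B> where \<B>: "countable \<B>" "\<forall>V\<in>\<B>. openin Y V"
      "\<forall>U x. openin Y U \<and> x \<in> U \<longrightarrow> (\<exists>V\<in>\<B>. x \<in> V \<and> V \<subseteq> U)"
    using assms(2) unfolding second_countable_def by metis
  let ?\<C> = "(\<lambda>(V, W). V \<times> W) ` (\<A> \<times> \<B>)"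
  show ?thesis
    unfolding second_countable_def
  proof (intro exI conjI ballI allI impI)
    show "countable ?\<C>"
      using \<A>(1) \<B>(1) by blast
    show "openin (prod_topology X Y) S" if "S \<in> ?\<C>" for S
      using that \<A>(2) \<B>(2) by (auto simp: openin_prod_Times_iff)
    fix S z assume "openin (prod_topology X Y) S \<and> z \<in> S"
    moreover obtain x y where z: "z = (x, y)"
      by fastforce
    ultimately obtain U U' where "openin X U" "openin Y U'" "x \<in> U" "y \<in> U'" "U \<times> U' \<subseteq> S"
      unfolding openin_prod_topology_alt by metis
    moreover obtain V where "V \<in> \<A>" "x \<in> V" "V \<subseteq> U"
      using \<A>(3) calculation by metis
    moreover obtain V' where "V' \<in> \<B>" "y \<in> V'" "V' \<subseteq> U'"
      using \<B>(3) calculation by metis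
    ultimately show "\<exists>C\<in>?\<C>. z \<in> C \<and> C \<subseteq> S"
      using z by (intro bexI[of _ "V \<times> V'"]) auto
  qed
qed

text \<open>A point is encoded by which members of a countable base contain it.\<close>

lemma second_countable_Hausdorff_inj_rvec:
  assumes "second_countable X" "Hausdorff_space X"
  obtains e :: "'a \<Rightarrow> rvec" where "inj_on e (topspace X)"
proof -
  obtain \<B> where \<B>: "countable \<B>" "\<forall>V\<in>\<B>. openin X V"
      "\<forall>U x. openin X U \<and> x \<in> U \<longrightarrow> (\<exists>V\<in>\<B>. x \<in> V \<and> V \<subseteq> U)"
    using assms(1) unfolding second_countable_def by metis
  define e :: "'a \<Rightarrow> rvec" where "e x k = of_bool (x \<in> from_nat_into \<B> k)" for x k
  have "x = y" if xy: "x \<in> topspace X" "y \<in> topspace X" "e x = e y" for x y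
  proof (rule ccontr)
    assume "x \<noteq> y"
    then obtain U where U: "openin X U" "x \<in> U" "y \<notin> U"
      using assms(2) xy(1,2) unfolding Hausdorff_space_def disjnt_iff by metis
    then obtain V where V: "V \<in> \<B>" "x \<in> V" "V \<subseteq> U"
      using \<B>(3) by metis
    then obtain k where "from_nat_into \<B> k = V"
      using from_nat_into_surj[OF \<B>(1)] by metis
    then have "e x k \<noteq> e y k"
      using U V by (auto simp: e_def)
    then show False using xy(3) by simp
  qed
  then show thesis
    by (intro that[of e] inj_onI)
qed

section \<open>Manifolds\<close>

lemma chart_domain_subset:
  assumes "smooth_atlas M" "(U, \<phi>) \<in> mfd_charts M"
  shows "U \<subseteq> mfd_points M"
  using assms unfolding smooth_atlas_def by auto

lemma chart_into_inj_on: "chart_into X E (U, \<phi>) \<Longrightarrow> inj_on \<phi> U"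
  unfolding chart_into_def homeomorphic_eq_everything_map
  by (auto dest!: openin_subset simp: Int_absorb1)

text \<open>Supplies the open coordinate domains of chart overlaps on which the partial derivatives
  of transition maps are two-sided.\<close>

lemma chart_into_openin_image:
  assumes "chart_into X E (U, \<phi>)" "openin X V" "V \<subseteq> U"
  shows "openin E (\<phi> ` V)"
proof -
  have hom: "homeomorphic_map (subtopology X U) (subtopology E (\<phi> ` U)) \<phi>"
    and U: "openin X U" "openin E (\<phi> ` U)"
    using assms(1) unfolding chart_into_def by auto
  have "openin (subtopology X U) V"
    using assms(2,3) U(1) by (simp add: openin_open_subtopology)
  then have "openin (subtopology E (\<phi> ` U)) (\<phi> ` V)"
    using homeomorphic_imp_open_map[OF hom] unfolding open_map_def by blast
  then show ?thesis
    using U(2) by (simp add: openin_open_subtopology)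
qed

lemma smooth_manifold_imp_with_boundary:
  "smooth_manifold M \<Longrightarrow> smooth_manifold_with_boundary M"
  unfolding smooth_manifold_def smooth_manifold_with_boundary_def by blast

lemma manifold_chart:
  assumes "smooth_manifold_with_boundary M" "(U, \<phi>) \<in> mfd_charts M"
  shows "U \<subseteq> mfd_points M" "inj_on \<phi> U" "\<phi> ` U \<subseteq> topspace (Euclidean_space (mfd_dim M))"
proof -
  have c: "chart_into (mfd_top M) (Euclidean_space (mfd_dim M)) (U, \<phi>) \<or>
      chart_into (mfd_top M) (half_space (mfd_dim M)) (U, \<phi>)"
    and "smooth_atlas M"
    using assms unfolding smooth_manifold_with_boundary_def by blast+
  then show "U \<subseteq> mfd_points M"
    using chart_domain_subset assms(2) by blast
  show "inj_on \<phi> U"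
    using c chart_into_inj_on by blast
  show "\<phi> ` U \<subseteq> topspace (Euclidean_space (mfd_dim M))"
    using c unfolding chart_into_def half_space_def by (auto dest!: openin_subset)
qed

lemma smooth_atlasI:
  assumes "(\<Union>c\<in>mfd_charts M. fst c) = mfd_points M"
    and "\<And>U \<phi> V \<psi>. (U, \<phi>) \<in> mfd_charts M \<Longrightarrow> (V, \<psi>) \<in> mfd_charts M \<Longrightarrow>
      smooth_vec_on (mfd_dim M) (mfd_dim M) (\<phi> ` (U \<inter> V)) (\<psi> \<circ> inv_into U \<phi>)"
  shows "smooth_atlas M"
  using assms unfolding smooth_atlas_def by (auto simp: case_prod_beta')

lemma smooth_atlas_transition:
  assumes "smooth_atlas M" "(U, \<phi>) \<in> mfd_charts M" "(V, \<psi>) \<in> mfd_charts M"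
  shows "smooth_vec_on (mfd_dim M) (mfd_dim M) (\<phi> ` (U \<inter> V)) (\<psi> \<circ> inv_into U \<phi>)"
  using bspec[OF bspec[OF conjunct2[OF assms(1)[unfolded smooth_atlas_def]] assms(2), unfolded split]
      assms(3), unfolded split] .

lemma smooth_mapI:
  assumes "continuous_map (mfd_top M) (mfd_top N) f"
    and "\<And>U \<phi> V \<psi>. (U, \<phi>) \<in> mfd_charts M \<Longrightarrow> (V, \<psi>) \<in> mfd_charts N \<Longrightarrow>
      smooth_vec_on (mfd_dim M) (mfd_dim N) (\<phi> ` (U \<inter> f -` V)) (\<psi> \<circ> f \<circ> inv_into U \<phi>)"
  shows "smooth_map M N f"
  using assms unfolding smooth_map_def by (auto simp: case_prod_beta')

lemma constant_rankI:
  assumes "\<And>U \<phi> V \<psi> p. (U, \<phi>) \<in> mfd_charts M \<Longrightarrow> (V, \<psi>) \<in> mfd_charts N \<Longrightarrow> p \<in> U \<inter> f -` V \<Longrightarrow>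
      vec_space.rank (mfd_dim N) (jacobian (mfd_dim M) (mfd_dim N) (\<phi> ` (U \<inter> f -` V))
        (\<psi> \<circ> f \<circ> inv_into U \<phi>) (\<phi> p)) = r"
  shows "constant_rank M N f"
  unfolding constant_rank_def
  by (intro exI[of _ r] ballI, simp only: split_paired_all split, intro ballI,
      simp only: split_paired_all split, intro ballI assms)

lemma smooth_map_in_charts:
  assumes "smooth_map M N f" "(U, \<phi>) \<in> mfd_charts M" "(V, \<psi>) \<in> mfd_charts N"
  shows "smooth_vec_on (mfd_dim M) (mfd_dim N) (\<phi> ` (U \<inter> f -` V)) (\<psi> \<circ> f \<circ> inv_into U \<phi>)"
  using bspec[OF bspec[OF conjunct2[OF assms(1)[unfolded smooth_map_def]] assms(2), unfolded split]
      assms(3), unfolded split] .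

lemma jacobian_cong:
  assumes "x \<in> S" "\<And>y. y \<in> S \<Longrightarrow> F y = G y"
  shows "jacobian m n S F x = jacobian m n S G x"
  unfolding jacobian_def using assms by (auto intro!: cong_mat partial_deriv_cong)

section \<open>Transport of a manifold along an injection\<close>

text \<open>Pulling the topology back along the inverse, with the image of \<open>e\<close> as
  carrier, makes \<open>e\<close> a homeomorphism. Composing the charts with the same inverse leaves
  every coordinate expression unchanged.\<close>

definition transport_mfd :: "('a \<Rightarrow> 'b) \<Rightarrow> 'a mfd \<Rightarrow> 'b mfd" where
  "transport_mfd e M =
     \<lparr>mfd_top = pullback_topology (e ` mfd_points M) (inv_into (mfd_points M) e) (mfd_top M),
      mfd_dim = mfd_dim M,
      mfd_charts = (\<lambda>(U, \<phi>). (e ` U, \<phi> \<circ> inv_into (mfd_points M) e)) ` mfd_charts M\<rparr>"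

lemma mfd_dim_transport [simp]: "mfd_dim (transport_mfd e M) = mfd_dim M"
  by (simp add: transport_mfd_def)

lemma mfd_charts_transport:
  "mfd_charts (transport_mfd e M) = (\<lambda>(U, \<phi>). (e ` U, \<phi> \<circ> inv_into (mfd_points M) e)) ` mfd_charts M"
  by (simp add: transport_mfd_def)

context
  fixes e :: "'a \<Rightarrow> 'b" and M :: "'a mfd"
  assumes inj: "inj_on e (mfd_points M)"
begin

private abbreviation (input) "e' \<equiv> inv_into (mfd_points M) e"

lemma homeomorphic_maps_transport:
  "homeomorphic_maps (mfd_top M) (mfd_top (transport_mfd e M)) e e'"
proof -
  have "continuous_map (mfd_top M) (mfd_top (transport_mfd e M)) e"
    unfolding transport_mfd_def mfd.simps
    by (rule continuous_map_pullback') (auto intro: continuous_map_eq[OF continuous_map_id] simp: inj)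
  moreover have "continuous_map (mfd_top (transport_mfd e M)) (mfd_top M) (id \<circ> e')"
    unfolding transport_mfd_def mfd.simps
    by (rule continuous_map_pullback[OF continuous_map_id])
  ultimately show ?thesis
    using inj unfolding homeomorphic_maps_def
    by (auto simp: transport_mfd_def topspace_pullback_topology)
qed

lemma mfd_points_transport: "mfd_points (transport_mfd e M) = e ` mfd_points M"
  using inj by (auto simp: transport_mfd_def topspace_pullback_topology)

lemma chart_into_transport:
  assumes "chart_into (mfd_top M) E (U, \<phi>)"
  shows "chart_into (mfd_top (transport_mfd e M)) E (e ` U, \<phi> \<circ> e')"
proof -
  have hom: "homeomorphic_map (mfd_top M) (mfd_top (transport_mfd e M)) e"
    and hom': "homeomorphic_map (mfd_top (transport_mfd e M)) (mfd_top M) e'"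
    using homeomorphic_maps_transport homeomorphic_maps_imp_map homeomorphic_maps_sym by metis+
  have U: "openin (mfd_top M) U" "U \<subseteq> mfd_points M"
    using assms openin_subset unfolding chart_into_def by auto
  have e'U: "e' ` e ` U = U"
    using inj U(2) by (simp add: inv_into_image_cancel)
  have image: "(\<phi> \<circ> e') ` (e ` U) = \<phi> ` U"
    unfolding image_comp[symmetric] e'U ..
  have "openin (mfd_top (transport_mfd e M)) (e ` U)"
    using homeomorphic_map_openness[OF hom U(2)] U(1) by simp
  moreover have "homeomorphic_map (subtopology (mfd_top (transport_mfd e M)) (e ` U)) (subtopology (mfd_top M) U) e'"
    by (rule homeomorphic_map_subtopologies[OF hom'])
      (use U(2) e'U in \<open>simp add: mfd_points_transport image_mono Int_absorb1\<close>)
  ultimately show ?thesis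
    using assms homeomorphic_map_compose unfolding chart_into_def split image by fast
qed

text \<open>An inverse chart of the transported manifold passes through \<open>e\<close>, which the
  next chart or map cancels again. Transition maps and coordinate expressions thus equal the old
  ones, and their smoothness is inherited by congruence.\<close>

lemma transport_chart_eq:
  assumes "U \<subseteq> mfd_points M" "inj_on \<phi> U" "x \<in> \<phi> ` U"
  shows "inv_into (e ` U) (\<phi> \<circ> e') x = e (inv_into U \<phi> x)"
proof (rule inv_into_f_eq)
  show "inj_on (\<phi> \<circ> e') (e ` U)"
    using assms(1,2) inj by (auto simp: inj_on_def subset_iff)
  show "e (inv_into U \<phi> x) \<in> e ` U"
    using assms(3) by (simp add: inv_into_into)
  show "(\<phi> \<circ> e') (e (inv_into U \<phi> x)) = x"
    using assms(1,3) inj by (simp add: f_inv_into_f inv_into_into subsetD)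
qed

context
  assumes M: "smooth_manifold_with_boundary M"
begin

lemma smooth_atlas_transport: "smooth_atlas (transport_mfd e M)"
proof (rule smooth_atlasI)
  have "(\<Union>c\<in>mfd_charts M. fst c) = mfd_points M"
    using M unfolding smooth_manifold_with_boundary_def smooth_atlas_def by (simp add: case_prod_beta')
  then have "(\<Union>c\<in>mfd_charts M. e ` fst c) = e ` mfd_points M"
    by (simp only: image_UN[symmetric])
  then show "(\<Union>c\<in>mfd_charts (transport_mfd e M). fst c) = mfd_points (transport_mfd e M)"
    unfolding mfd_points_transport mfd_charts_transport by (simp add: case_prod_beta')
next
  fix U' \<phi>' V' \<psi>' assume "(U', \<phi>') \<in> mfd_charts (transport_mfd e M)" "(V', \<psi>') \<in> mfd_charts (transport_mfd e M)"
  then obtain U \<phi> V \<psi> where c: "U' = e ` U" "\<phi>' = \<phi> \<circ> e'" "(U, \<phi>) \<in> mfd_charts M"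
      and d: "V' = e ` V" "\<psi>' = \<psi> \<circ> e'" "(V, \<psi>) \<in> mfd_charts M"
    unfolding mfd_charts_transport by auto
  note U = manifold_chart[OF M c(3)] and V = manifold_chart[OF M d(3)]
  have "e ` U \<inter> e ` V = e ` (U \<inter> V)"
    using inj_on_image_Int[OF inj U(1) V(1)] by simp
  moreover have "e' ` e ` (U \<inter> V) = U \<inter> V"
    using inj U(1) by (intro inv_into_image_cancel) auto
  ultimately have S: "(\<phi> \<circ> e') ` (e ` U \<inter> e ` V) = \<phi> ` (U \<inter> V)"
    by (simp only: image_comp[symmetric])
  have "smooth_vec_on (mfd_dim M) (mfd_dim M) (\<phi> ` (U \<inter> V)) (\<psi> \<circ> inv_into U \<phi>)"
    using M c(3) d(3) by (intro smooth_atlas_transition) (auto simp: smooth_manifold_with_boundary_def)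
  then have "smooth_vec_on (mfd_dim M) (mfd_dim M) (\<phi> ` (U \<inter> V))
      ((\<psi> \<circ> e') \<circ> inv_into (e ` U) (\<phi> \<circ> e'))"
  proof (rule smooth_vec_on_cong)
    fix x assume "x \<in> \<phi> ` (U \<inter> V)"
    then have x: "x \<in> \<phi> ` U" by blast
    have "inv_into U \<phi> x \<in> mfd_points M"
      by (rule subsetD[OF U(1) inv_into_into[OF x]])
    then show "(\<psi> \<circ> inv_into U \<phi>) x = ((\<psi> \<circ> e') \<circ> inv_into (e ` U) (\<phi> \<circ> e')) x"
      using inj by (simp add: transport_chart_eq[OF U(1,2) x])
  qed
  then show "smooth_vec_on (mfd_dim (transport_mfd e M)) (mfd_dim (transport_mfd e M))
      (\<phi>' ` (U' \<inter> V')) (\<psi>' \<circ> inv_into U' \<phi>')"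
    unfolding c(1,2) d(1,2) S by simp
qed

lemma smooth_manifold_with_boundary_transport:
  "smooth_manifold_with_boundary (transport_mfd e M)"
  unfolding smooth_manifold_with_boundary_def
proof (intro conjI ballI)
  have hs: "mfd_top M homeomorphic_space mfd_top (transport_mfd e M)"
    using homeomorphic_maps_transport unfolding homeomorphic_space_def by blast
  show "Hausdorff_space (mfd_top (transport_mfd e M))"
    using M homeomorphic_Hausdorff_space[OF hs] unfolding smooth_manifold_with_boundary_def by blast
  show "second_countable (mfd_top (transport_mfd e M))"
    using M homeomorphic_space_second_countability[OF hs] unfolding smooth_manifold_with_boundary_def by blast
  show "smooth_atlas (transport_mfd e M)"
    by (rule smooth_atlas_transport)
  fix c assume "c \<in> mfd_charts (transport_mfd e M)"
  then obtain U \<phi> where c: "c = (e ` U, \<phi> \<circ> e')" "(U, \<phi>) \<in> mfd_charts M"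
    unfolding mfd_charts_transport by auto
  then have "chart_into (mfd_top M) (Euclidean_space (mfd_dim M)) (U, \<phi>) \<or>
      chart_into (mfd_top M) (half_space (mfd_dim M)) (U, \<phi>)"
    using M unfolding smooth_manifold_with_boundary_def by blast
  then show "chart_into (mfd_top (transport_mfd e M)) (Euclidean_space (mfd_dim (transport_mfd e M))) c \<or>
      chart_into (mfd_top (transport_mfd e M)) (half_space (mfd_dim (transport_mfd e M))) c"
    unfolding c(1) mfd_dim_transport using chart_into_transport by blast
qed

lemma smooth_map_from_transport:
  assumes f: "smooth_map M N f"
  shows "smooth_map (transport_mfd e M) N (f \<circ> e')"
proof (rule smooth_mapI)
  have "continuous_map (mfd_top (transport_mfd e M)) (mfd_top M) e'"
    using homeomorphic_maps_transport unfolding homeomorphic_maps_def by blast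
  then show "continuous_map (mfd_top (transport_mfd e M)) (mfd_top N) (f \<circ> e')"
    using f unfolding smooth_map_def by (intro continuous_map_compose[of _ "mfd_top M"]) auto
next
  fix U' \<phi>' V \<psi> assume "(U', \<phi>') \<in> mfd_charts (transport_mfd e M)" and d: "(V, \<psi>) \<in> mfd_charts N"
  then obtain U \<phi> where c: "U' = e ` U" "\<phi>' = \<phi> \<circ> e'" "(U, \<phi>) \<in> mfd_charts M"
    unfolding mfd_charts_transport by auto
  note U = manifold_chart[OF M c(3)]
  have "e' ` (e ` U \<inter> (f \<circ> e') -` V) = U \<inter> f -` V"
  proof -
    have "e' (e p) = p" if "p \<in> U" for p
      using that inj U(1) by (auto intro: inv_into_f_f)
    then show ?thesis by force
  qed
  then have S: "(\<phi> \<circ> e') ` (e ` U \<inter> (f \<circ> e') -` V) = \<phi> ` (U \<inter> f -` V)"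
    by (simp only: image_comp[symmetric])
  have "smooth_vec_on (mfd_dim M) (mfd_dim N) (\<phi> ` (U \<inter> f -` V))
      (\<psi> \<circ> (f \<circ> e') \<circ> inv_into (e ` U) (\<phi> \<circ> e'))"
  proof (rule smooth_vec_on_cong[OF smooth_map_in_charts[OF f c(3) d]])
    fix x assume "x \<in> \<phi> ` (U \<inter> f -` V)"
    then have x: "x \<in> \<phi> ` U" by blast
    have "inv_into U \<phi> x \<in> mfd_points M"
      by (rule subsetD[OF U(1) inv_into_into[OF x]])
    then show "(\<psi> \<circ> f \<circ> inv_into U \<phi>) x = (\<psi> \<circ> (f \<circ> e') \<circ> inv_into (e ` U) (\<phi> \<circ> e')) x"
      using inj by (simp add: transport_chart_eq[OF U(1,2) x])
  qed
  then show "smooth_vec_on (mfd_dim (transport_mfd e M)) (mfd_dim N) (\<phi>' ` (U' \<inter> (f \<circ> e') -` V))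
        (\<psi> \<circ> (f \<circ> e') \<circ> inv_into U' \<phi>')"
    unfolding c(1,2) S by simp
qed

text \<open>A Jacobian depends on the domain of the coordinate expression as well as on its values,
  so both are compared. Smoothness and constant rank of \<open>e \<circ> f\<close> then reduce to
  those of \<open>f\<close>.\<close>

lemma chart_of_map_into_transport:
  assumes f: "f \<in> mfd_points L \<rightarrow> mfd_points M" and U: "U \<subseteq> mfd_points L" and V: "V \<subseteq> mfd_points M"
  shows "U \<inter> (e \<circ> f) -` (e ` V) = U \<inter> f -` V"
    and "x \<in> \<phi> ` (U \<inter> f -` V) \<Longrightarrow> (\<psi> \<circ> f \<circ> inv_into U \<phi>) x = ((\<psi> \<circ> e') \<circ> (e \<circ> f) \<circ> inv_into U \<phi>) x"
proof -
  show "U \<inter> (e \<circ> f) -` (e ` V) = U \<inter> f -` V"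
  proof (rule Set.set_eqI)
    fix p
    have "p \<in> U \<Longrightarrow> f p \<in> mfd_points M"
      using f U by blast
    then have "p \<in> U \<Longrightarrow> e (f p) \<in> e ` V \<longleftrightarrow> f p \<in> V"
      using inj_on_image_mem_iff[OF inj _ V] by simp
    then show "p \<in> U \<inter> (e \<circ> f) -` (e ` V) \<longleftrightarrow> p \<in> U \<inter> f -` V"
      unfolding Int_iff vimage_eq comp_apply by argo
  qed
  assume "x \<in> \<phi> ` (U \<inter> f -` V)"
  then have "x \<in> \<phi> ` U"
    by blast
  then have "inv_into U \<phi> x \<in> U"
    by (rule inv_into_into)
  then have "f (inv_into U \<phi> x) \<in> mfd_points M"
    using f U by blast
  then show "(\<psi> \<circ> f \<circ> inv_into U \<phi>) x = ((\<psi> \<circ> e') \<circ> (e \<circ> f) \<circ> inv_into U \<phi>) x"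
    using inj by simp
qed

lemma smooth_map_into_transport:
  assumes L: "smooth_atlas L" and f: "smooth_map L M f"
  shows "smooth_map L (transport_mfd e M) (e \<circ> f)"
proof (rule smooth_mapI)
  have cont: "continuous_map (mfd_top L) (mfd_top M) f"
    using f unfolding smooth_map_def by blast
  moreover have "continuous_map (mfd_top M) (mfd_top (transport_mfd e M)) e"
    using homeomorphic_maps_transport unfolding homeomorphic_maps_def by blast
  ultimately show "continuous_map (mfd_top L) (mfd_top (transport_mfd e M)) (e \<circ> f)"
    by (rule continuous_map_compose)
  fix U \<phi> V' \<psi>' assume c: "(U, \<phi>) \<in> mfd_charts L" and "(V', \<psi>') \<in> mfd_charts (transport_mfd e M)"
  then obtain V \<psi> where d: "V' = e ` V" "\<psi>' = \<psi> \<circ> e'" "(V, \<psi>) \<in> mfd_charts M"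
    unfolding mfd_charts_transport by auto
  note * = chart_of_map_into_transport[OF continuous_map_funspace[OF cont]
      chart_domain_subset[OF L c] manifold_chart(1)[OF M d(3)]]
  have "smooth_vec_on (mfd_dim L) (mfd_dim M) (\<phi> ` (U \<inter> f -` V))
      ((\<psi> \<circ> e') \<circ> (e \<circ> f) \<circ> inv_into U \<phi>)"
    using smooth_vec_on_cong[OF smooth_map_in_charts[OF f c d(3)] *(2)] .
  then show "smooth_vec_on (mfd_dim L) (mfd_dim (transport_mfd e M)) (\<phi> ` (U \<inter> (e \<circ> f) -` V'))
        (\<psi>' \<circ> (e \<circ> f) \<circ> inv_into U \<phi>)"
    unfolding d(1,2) *(1) by simp
qed

lemma constant_rank_into_transport:
  assumes L: "smooth_atlas L" and f: "smooth_map L M f" and r: "constant_rank L M f"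
  shows "constant_rank L (transport_mfd e M) (e \<circ> f)"
proof -
  have cont: "continuous_map (mfd_top L) (mfd_top M) f"
    using f unfolding smooth_map_def by blast
  obtain r where r: "\<And>U \<phi> V \<psi> p. (U, \<phi>) \<in> mfd_charts L \<Longrightarrow> (V, \<psi>) \<in> mfd_charts M \<Longrightarrow> p \<in> U \<inter> f -` V \<Longrightarrow>
      vec_space.rank (mfd_dim M) (jacobian (mfd_dim L) (mfd_dim M) (\<phi> ` (U \<inter> f -` V))
        (\<psi> \<circ> f \<circ> inv_into U \<phi>) (\<phi> p)) = r"
    using r unfolding constant_rank_def by fast
  have "vec_space.rank (mfd_dim M) (jacobian (mfd_dim L) (mfd_dim M) (\<phi> ` (U \<inter> (e \<circ> f) -` (e ` V)))
        ((\<psi> \<circ> e') \<circ> (e \<circ> f) \<circ> inv_into U \<phi>) (\<phi> p)) = r"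
    if c: "(U, \<phi>) \<in> mfd_charts L" and d: "(V, \<psi>) \<in> mfd_charts M" and p: "p \<in> U \<inter> (e \<circ> f) -` (e ` V)"
    for U \<phi> V \<psi> p
  proof -
    note * = chart_of_map_into_transport[OF continuous_map_funspace[OF cont]
        chart_domain_subset[OF L c] manifold_chart(1)[OF M d]]
    have "jacobian (mfd_dim L) (mfd_dim M) (\<phi> ` (U \<inter> f -` V)) (\<psi> \<circ> f \<circ> inv_into U \<phi>) (\<phi> p) =
        jacobian (mfd_dim L) (mfd_dim M) (\<phi> ` (U \<inter> f -` V)) ((\<psi> \<circ> e') \<circ> (e \<circ> f) \<circ> inv_into U \<phi>) (\<phi> p)"
      using p[unfolded *(1)] by (intro jacobian_cong *(2)) auto
    then show ?thesis
      using r[OF c d p[unfolded *(1)]] unfolding *(1) by simp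
  qed
  then show ?thesis
    by (intro constant_rankI[where r = r]) (auto simp: mfd_charts_transport)
qed

end

end

section \<open>Products of manifolds\<close>

text \<open>The gluing inside the charts of \<open>prod_mfd\<close>, separated out so that a product
  chart is a pair of charts followed by a homeomorphism.\<close>

definition rvec_append :: "nat \<Rightarrow> rvec \<times> rvec \<Rightarrow> rvec" where
  "rvec_append m = (\<lambda>(x, y) i. if i < m then x i else y (i - m))"

lemma block_rvec_append:
  assumes "x \<in> topspace (Euclidean_space m)" "y \<in> topspace (Euclidean_space k)"
  shows "block 0 m (rvec_append m (x, y)) = x" "block m k (rvec_append m (x, y)) = y"
  using assms by (auto simp: block_def rvec_append_def topspace_Euclidean_space fun_eq_iff)

lemma rvec_append_block:
  assumes "z \<in> topspace (Euclidean_space (m + k))"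
  shows "rvec_append m (block 0 m z, block m k z) = z"
  using assms by (auto simp: block_def rvec_append_def topspace_Euclidean_space fun_eq_iff)

lemma rvec_append_in_Euclidean_space:
  assumes "x \<in> topspace (Euclidean_space m)" "y \<in> topspace (Euclidean_space k)"
  shows "rvec_append m (x, y) \<in> topspace (Euclidean_space (m + k))"
  using assms by (auto simp: rvec_append_def topspace_Euclidean_space)

lemma homeomorphic_maps_rvec_append:
  "homeomorphic_maps (prod_topology (Euclidean_space m) (Euclidean_space k)) (Euclidean_space (m + k))
     (rvec_append m) (\<lambda>z. (block 0 m z, block m k z))"
  unfolding homeomorphic_maps_def
proof (intro conjI ballI)
  have coord: "continuous_map (Euclidean_space n) euclideanreal (\<lambda>x. x i)" for n i
    using continuous_map_Euclidean_coordinate[of n UNIV i] by simp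
  have "continuous_map (prod_topology (Euclidean_space m) (Euclidean_space k)) euclideanreal (\<lambda>p. rvec_append m p i)" for i
  proof (cases "i < m")
    case True
    then have "(\<lambda>p. rvec_append m p i) = (\<lambda>x. x i) \<circ> fst"
      by (auto simp: rvec_append_def)
    then show ?thesis
      using continuous_map_compose[OF continuous_map_fst coord] by metis
  next
    case False
    then have "(\<lambda>p. rvec_append m p i) = (\<lambda>x. x (i - m)) \<circ> snd"
      by (auto simp: rvec_append_def)
    then show ?thesis
      using continuous_map_compose[OF continuous_map_snd coord] by metis
  qed
  then have "continuous_map (prod_topology (Euclidean_space m) (Euclidean_space k)) (powertop_real UNIV) (rvec_append m)"
    unfolding continuous_map_componentwise_UNIV by blast
  moreover have "rvec_append m \<in> topspace (prod_topology (Euclidean_space m) (Euclidean_space k)) \<rightarrow> {x. \<forall>i\<ge>m + k. x i = 0}"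
    by (auto simp: rvec_append_def topspace_Euclidean_space)
  ultimately show "continuous_map (prod_topology (Euclidean_space m) (Euclidean_space k)) (Euclidean_space (m + k)) (rvec_append m)"
    unfolding Euclidean_space_def[of "m + k"] by (rule continuous_map_into_subtopology)
  show "continuous_map (Euclidean_space (m + k)) (prod_topology (Euclidean_space m) (Euclidean_space k))
      (\<lambda>z. (block 0 m z, block m k z))"
    by (intro continuous_map_pairedI continuous_map_block)
qed (auto simp: block_rvec_append rvec_append_block)

lemma homeomorphic_map_rvec_append:
  "homeomorphic_map (prod_topology (Euclidean_space m) (Euclidean_space k)) (Euclidean_space (m + k)) (rvec_append m)"
  using homeomorphic_maps_rvec_append homeomorphic_maps_imp_map by blast

text \<open>For \<open>k > 0\<close> the last coordinate overall is the last coordinate of the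
  second block, so the two sign conditions match. For \<open>k = 0\<close> index
  \<open>m + k - 1\<close> would fall into the first factor, which is unconstrained.\<close>

lemma homeomorphic_map_rvec_append_half_space:
  assumes "k > 0"
  shows "homeomorphic_map (prod_topology (Euclidean_space m) (half_space k)) (half_space (m + k)) (rvec_append m)"
  unfolding half_space_def prod_topology_subtopology(2)
proof (rule homeomorphic_map_subtopologies_alt[OF homeomorphic_map_rvec_append])
  fix p assume "p \<in> topspace (prod_topology (Euclidean_space m) (Euclidean_space k))"
  then show "rvec_append m p \<in> {x. 0 \<le> x (m + k - 1)} \<longleftrightarrow> p \<in> topspace (Euclidean_space m) \<times> {x. 0 \<le> x (k - 1)}"
    using assms by (cases p) (auto simp: rvec_append_def)
qed

text \<open>The gluing map \<open>J\<close> is kept abstract so that the same argument yields charts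
  into the full space and into a half space.\<close>

lemma chart_into_prod:
  assumes \<phi>: "chart_into X E (U, \<phi>)" and \<psi>: "chart_into Y F (V, \<psi>)"
    and J: "homeomorphic_map (prod_topology E F) G J"
  shows "chart_into (prod_topology X Y) G (U \<times> V, \<lambda>(p, q). J (\<phi> p, \<psi> q))"
proof -
  let ?f = "\<lambda>(p, q). (\<phi> p, \<psi> q)"
  have f_image: "?f ` (U \<times> V) = \<phi> ` U \<times> \<psi> ` V"
    by auto
  have eq: "(\<lambda>(p, q). J (\<phi> p, \<psi> q)) = J \<circ> ?f"
    by auto
  have image: "(\<lambda>(p, q). J (\<phi> p, \<psi> q)) ` (U \<times> V) = J ` (\<phi> ` U \<times> \<psi> ` V)"
    unfolding eq image_comp[symmetric] f_image ..
  have opens: "openin X U" "openin E (\<phi> ` U)" "openin Y V" "openin F (\<psi> ` V)"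
    using \<phi> \<psi> unfolding chart_into_def by auto
  then have sub: "\<phi> ` U \<times> \<psi> ` V \<subseteq> topspace (prod_topology E F)"
    using openin_subset by fastforce
  have "openin (prod_topology E F) (\<phi> ` U \<times> \<psi> ` V)"
    using opens by (simp add: openin_prod_Times_iff)
  then have open_image: "openin G (J ` (\<phi> ` U \<times> \<psi> ` V))"
    using homeomorphic_map_openness[OF J sub] by simp
  obtain \<phi>' \<psi>' where "homeomorphic_maps (subtopology X U) (subtopology E (\<phi> ` U)) \<phi> \<phi>'"
      "homeomorphic_maps (subtopology Y V) (subtopology F (\<psi> ` V)) \<psi> \<psi>'"
    using \<phi> \<psi> unfolding chart_into_def homeomorphic_map_maps by auto
  then have "homeomorphic_maps (prod_topology (subtopology X U) (subtopology Y V))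
      (prod_topology (subtopology E (\<phi> ` U)) (subtopology F (\<psi> ` V))) ?f (\<lambda>(x, y). (\<phi>' x, \<psi>' y))"
    unfolding homeomorphic_maps_prod by blast
  then have "homeomorphic_map (subtopology (prod_topology X Y) (U \<times> V))
      (subtopology (prod_topology E F) (\<phi> ` U \<times> \<psi> ` V)) ?f"
    unfolding subtopology_Times by (rule homeomorphic_maps_imp_map)
  moreover have "homeomorphic_map (subtopology (prod_topology E F) (\<phi> ` U \<times> \<psi> ` V))
      (subtopology G (J ` (\<phi> ` U \<times> \<psi> ` V))) J"
  proof (rule homeomorphic_map_subtopologies[OF J])
    show "J ` (topspace (prod_topology E F) \<inter> \<phi> ` U \<times> \<psi> ` V) = topspace G \<inter> J ` (\<phi> ` U \<times> \<psi> ` V)"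
      using sub openin_subset[OF open_image] by (metis Int_absorb1)
  qed
  ultimately have "homeomorphic_map (subtopology (prod_topology X Y) (U \<times> V))
      (subtopology G (J ` (\<phi> ` U \<times> \<psi> ` V))) (\<lambda>(p, q). J (\<phi> p, \<psi> q))"
    unfolding eq by (rule homeomorphic_map_compose)
  then show ?thesis
    unfolding chart_into_def split image using opens open_image by (simp add: openin_prod_Times_iff)
qed

section \<open>The product manifold and its atlas\<close>

lemma prod_mfd_simps [simp]:
  "mfd_top (prod_mfd M N) = prod_topology (mfd_top M) (mfd_top N)"
  "mfd_dim (prod_mfd M N) = mfd_dim M + mfd_dim N"
  by (simp_all add: prod_mfd_def)

lemma mfd_charts_prod:
  "mfd_charts (prod_mfd M N) = {(U \<times> V, \<lambda>(p, q). rvec_append (mfd_dim M) (\<phi> p, \<psi> q)) | U \<phi> V \<psi>.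
     (U, \<phi>) \<in> mfd_charts M \<and> (V, \<psi>) \<in> mfd_charts N}"
  by (simp add: prod_mfd_def rvec_append_def)

lemma prod_chartE:
  assumes "(W, \<theta>) \<in> mfd_charts (prod_mfd M N)"
  obtains U \<phi> V \<psi> where "W = U \<times> V" "\<theta> = (\<lambda>(p, q). rvec_append (mfd_dim M) (\<phi> p, \<psi> q))"
    "(U, \<phi>) \<in> mfd_charts M" "(V, \<psi>) \<in> mfd_charts N"
  using assms unfolding mfd_charts_prod by auto

lemma inv_into_prod_chart:
  assumes "inj_on \<phi> U" "\<phi> ` U \<subseteq> topspace (Euclidean_space m)"
    and "inj_on \<psi> V" "\<psi> ` V \<subseteq> topspace (Euclidean_space k)" and "p \<in> U" "q \<in> V"
  shows "inv_into (U \<times> V) (\<lambda>(p, q). rvec_append m (\<phi> p, \<psi> q)) (rvec_append m (\<phi> p, \<psi> q)) = (p, q)"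
proof (rule inv_into_f_eq)
  show "inj_on (\<lambda>(p, q). rvec_append m (\<phi> p, \<psi> q)) (U \<times> V)"
  proof (rule inj_onI, clarify)
    fix p q p' q' assume *: "p \<in> U" "q \<in> V" "p' \<in> U" "q' \<in> V"
      "rvec_append m (\<phi> p, \<psi> q) = rvec_append m (\<phi> p', \<psi> q')"
    have "\<phi> p \<in> topspace (Euclidean_space m)" "\<phi> p' \<in> topspace (Euclidean_space m)"
        "\<psi> q \<in> topspace (Euclidean_space k)" "\<psi> q' \<in> topspace (Euclidean_space k)"
      using * assms(2,4) by blast+
    then have "\<phi> p = \<phi> p'" "\<psi> q = \<psi> q'"
      using block_rvec_append *(5) by metis+
    then show "p = p' \<and> q = q'"
      using * assms(1,3) by (auto dest: inj_onD)
  qed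
qed (use assms in auto)

text \<open>A transition map of the product acts on the two blocks separately. Each of its
  coordinates is a coordinate of a transition map of one factor after a block projection, and local
  extensions pull back along such projections, at boundary points too.\<close>

lemma smooth_atlas_prod:
  assumes M: "smooth_manifold_with_boundary M" and N: "smooth_manifold_with_boundary N"
  shows "smooth_atlas (prod_mfd M N)"
proof (rule smooth_atlasI)
  have atlas: "smooth_atlas M" "smooth_atlas N"
    using M N unfolding smooth_manifold_with_boundary_def by blast+
  have cover: "(\<Union>c\<in>mfd_charts M. fst c) = mfd_points M" "(\<Union>c\<in>mfd_charts N. fst c) = mfd_points N"
    using conjunct1[OF atlas(1)[unfolded smooth_atlas_def]] conjunct1[OF atlas(2)[unfolded smooth_atlas_def]]
    by (simp_all add: case_prod_beta')
  show "(\<Union>c\<in>mfd_charts (prod_mfd M N). fst c) = mfd_points (prod_mfd M N)"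
    unfolding prod_mfd_simps topspace_prod_topology
  proof (intro equalityI subsetI)
    fix z assume "z \<in> (\<Union>c\<in>mfd_charts (prod_mfd M N). fst c)"
    then obtain U \<phi> V \<psi> where "z \<in> U \<times> V" "(U, \<phi>) \<in> mfd_charts M" "(V, \<psi>) \<in> mfd_charts N"
      unfolding mfd_charts_prod by auto
    then show "z \<in> mfd_points M \<times> mfd_points N"
      using manifold_chart(1)[OF M] manifold_chart(1)[OF N] by blast
  next
    fix z assume z: "z \<in> mfd_points M \<times> mfd_points N"
    obtain c where c: "c \<in> mfd_charts M" "fst z \<in> fst c"
      using z unfolding cover(1)[symmetric] by auto
    obtain d where d: "d \<in> mfd_charts N" "snd z \<in> fst d"
      using z unfolding cover(2)[symmetric] by auto
    have "(fst c \<times> fst d, \<lambda>(p, q). rvec_append (mfd_dim M) (snd c p, snd d q)) \<in> mfd_charts (prod_mfd M N)"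
      unfolding mfd_charts_prod using c(1) d(1) by fastforce
    then show "z \<in> (\<Union>c\<in>mfd_charts (prod_mfd M N). fst c)"
      by (rule UN_I) (use c(2) d(2) in \<open>simp add: mem_Times_iff\<close>)
  qed
  fix W \<theta> W' \<theta>'
  assume "(W, \<theta>) \<in> mfd_charts (prod_mfd M N)" "(W', \<theta>') \<in> mfd_charts (prod_mfd M N)"
  then obtain U \<phi> V \<psi> U' \<phi>' V' \<psi>'
    where W: "W = U \<times> V" "\<theta> = (\<lambda>(p, q). rvec_append (mfd_dim M) (\<phi> p, \<psi> q))"
      and U: "(U, \<phi>) \<in> mfd_charts M" and V: "(V, \<psi>) \<in> mfd_charts N"
      and W': "W' = U' \<times> V'" "\<theta>' = (\<lambda>(p, q). rvec_append (mfd_dim M) (\<phi>' p, \<psi>' q))"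
      and U': "(U', \<phi>') \<in> mfd_charts M" and V': "(V', \<psi>') \<in> mfd_charts N"
    by (elim prod_chartE)
  note cU = manifold_chart[OF M U] and cV = manifold_chart[OF N V]
  let ?m = "mfd_dim M" and ?k = "mfd_dim N" and ?T = "\<theta> ` (W \<inter> W')"
  \<comment> \<open>The blocks of a point of the overlap are the coordinates of \<open>p\<close> and
    \<open>q\<close>, and the inverse chart returns this pair; both kinds of coordinates are read
    off from here.\<close>
  have T: "\<exists>p q. z = rvec_append ?m (\<phi> p, \<psi> q) \<and> p \<in> U \<inter> U' \<and> q \<in> V \<inter> V' \<and>
      block 0 ?m z = \<phi> p \<and> block ?m ?k z = \<psi> q \<and> z \<in> topspace (Euclidean_space (?m + ?k)) \<and>
      inv_into W \<theta> z = (p, q)" if zT: "z \<in> ?T" for z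
  proof -
    obtain p q where z: "z = rvec_append ?m (\<phi> p, \<psi> q)" and pq: "p \<in> U \<inter> U'" "q \<in> V \<inter> V'"
      using zT unfolding W W'(1) by auto
    then have "\<phi> p \<in> topspace (Euclidean_space ?m)" "\<psi> q \<in> topspace (Euclidean_space ?k)"
      using cU(3) cV(3) by blast+
    moreover have "inv_into W \<theta> z = (p, q)"
      unfolding W z using pq by (intro inv_into_prod_chart[OF cU(2,3) cV(2,3)]) auto
    ultimately show ?thesis
      using z pq block_rvec_append rvec_append_in_Euclidean_space by metis
  qed
  have "smooth_on (?m + ?k) ?T (\<lambda>z. (\<theta>' \<circ> inv_into W \<theta>) z j)" if "j < ?m + ?k" for j
  proof (cases "j < ?m")
    case True
    have "smooth_on (?m + ?k) ?T (\<lambda>z. (\<phi>' \<circ> inv_into U \<phi>) (block 0 ?m z) j)"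
    proof (rule smooth_on_block)
      show "smooth_on ?m (\<phi> ` (U \<inter> U')) (\<lambda>x. (\<phi>' \<circ> inv_into U \<phi>) x j)"
        using smooth_atlas_transition[OF atlas(1) U U'] True unfolding smooth_vec_on_def by blast
    qed (use T in blast)+
    then show ?thesis
    proof (rule smooth_on_cong)
      fix z assume "z \<in> ?T"
      with T obtain p q where "p \<in> U" "block 0 ?m z = \<phi> p" "inv_into W \<theta> z = (p, q)"
        by blast
      then show "(\<phi>' \<circ> inv_into U \<phi>) (block 0 ?m z) j = (\<theta>' \<circ> inv_into W \<theta>) z j"
        using True cU(2) by (simp add: W'(2) rvec_append_def)
    qed
  next
    case False
    have "smooth_on (?m + ?k) ?T (\<lambda>z. (\<psi>' \<circ> inv_into V \<psi>) (block ?m ?k z) (j - ?m))"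
    proof (rule smooth_on_block)
      show "smooth_on ?k (\<psi> ` (V \<inter> V')) (\<lambda>x. (\<psi>' \<circ> inv_into V \<psi>) x (j - ?m))"
        using smooth_atlas_transition[OF atlas(2) V V'] False that unfolding smooth_vec_on_def by auto
    qed (use T in blast)+
    then show ?thesis
    proof (rule smooth_on_cong)
      fix z assume "z \<in> ?T"
      with T obtain p q where "q \<in> V" "block ?m ?k z = \<psi> q" "inv_into W \<theta> z = (p, q)"
        by blast
      then show "(\<psi>' \<circ> inv_into V \<psi>) (block ?m ?k z) (j - ?m) = (\<theta>' \<circ> inv_into W \<theta>) z j"
        using False cV(2) by (simp add: W'(2) rvec_append_def)
    qed
  qed
  then show "smooth_vec_on (mfd_dim (prod_mfd M N)) (mfd_dim (prod_mfd M N)) ?T (\<theta>' \<circ> inv_into W \<theta>)"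
    unfolding smooth_vec_on_def by simp
qed

lemma smooth_manifold_with_boundary_prod:
  assumes M: "smooth_manifold M" and N: "smooth_manifold_with_boundary N" and dim: "mfd_dim N > 0"
  shows "smooth_manifold_with_boundary (prod_mfd M N)"
  unfolding smooth_manifold_with_boundary_def
proof (intro conjI ballI)
  show "Hausdorff_space (mfd_top (prod_mfd M N))"
    using M N unfolding smooth_manifold_def smooth_manifold_with_boundary_def
    by (simp add: Hausdorff_space_prod_topology)
  show "second_countable (mfd_top (prod_mfd M N))"
    using M N unfolding smooth_manifold_def smooth_manifold_with_boundary_def
    by (simp add: second_countable_prod_topology)
  show "smooth_atlas (prod_mfd M N)"
    by (rule smooth_atlas_prod[OF smooth_manifold_imp_with_boundary[OF M] N])
  fix c assume "c \<in> mfd_charts (prod_mfd M N)"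
  then obtain U \<phi> V \<psi> where c: "c = (U \<times> V, \<lambda>(p, q). rvec_append (mfd_dim M) (\<phi> p, \<psi> q))"
      and U: "(U, \<phi>) \<in> mfd_charts M" and V: "(V, \<psi>) \<in> mfd_charts N"
    unfolding mfd_charts_prod by auto
  have "chart_into (mfd_top M) (Euclidean_space (mfd_dim M)) (U, \<phi>)"
    using M U unfolding smooth_manifold_def by blast
  moreover have "chart_into (mfd_top N) (Euclidean_space (mfd_dim N)) (V, \<psi>) \<or>
      chart_into (mfd_top N) (half_space (mfd_dim N)) (V, \<psi>)"
    using N V unfolding smooth_manifold_with_boundary_def by blast
  ultimately show "chart_into (mfd_top (prod_mfd M N)) (Euclidean_space (mfd_dim (prod_mfd M N))) c \<or>
      chart_into (mfd_top (prod_mfd M N)) (half_space (mfd_dim (prod_mfd M N))) c"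
    unfolding c prod_mfd_simps
    using chart_into_prod homeomorphic_map_rvec_append homeomorphic_map_rvec_append_half_space[OF dim] by metis
qed

section \<open>Slices of a product\<close>

lemma smooth_map_slice:
  assumes M: "smooth_manifold M" and q: "q \<in> mfd_points N"
  shows "smooth_map M (prod_mfd M N) (\<lambda>p. (p, q))"
proof (rule smooth_mapI)
  show "continuous_map (mfd_top M) (mfd_top (prod_mfd M N)) (\<lambda>p. (p, q))"
    using q by (simp add: continuous_map_pairedI)
  fix U \<phi> X \<theta> assume U: "(U, \<phi>) \<in> mfd_charts M" and "(X, \<theta>) \<in> mfd_charts (prod_mfd M N)"
  then obtain V \<psi> W \<eta> where X: "X = V \<times> W" "\<theta> = (\<lambda>(p, q). rvec_append (mfd_dim M) (\<psi> p, \<eta> q))"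
      and V: "(V, \<psi>) \<in> mfd_charts M"
    by (elim prod_chartE)
  note cU = manifold_chart[OF smooth_manifold_imp_with_boundary[OF M] U]
  show "smooth_vec_on (mfd_dim M) (mfd_dim (prod_mfd M N)) (\<phi> ` (U \<inter> (\<lambda>p. (p, q)) -` X))
      (\<theta> \<circ> (\<lambda>p. (p, q)) \<circ> inv_into U \<phi>)"
  proof (cases "q \<in> W")
    case True
    then have S: "U \<inter> (\<lambda>p. (p, q)) -` X = U \<inter> V"
      unfolding X by auto
    have "smooth_on (mfd_dim M) (\<phi> ` (U \<inter> V)) (\<lambda>x. (\<theta> \<circ> (\<lambda>p. (p, q)) \<circ> inv_into U \<phi>) x j)" for j
    proof (cases "j < mfd_dim M")
      case True
      have "smooth_atlas M"
        using M unfolding smooth_manifold_def by blast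
      from smooth_atlas_transition[OF this U V] True
      have "smooth_on (mfd_dim M) (\<phi> ` (U \<inter> V)) (\<lambda>x. (\<psi> \<circ> inv_into U \<phi>) x j)"
        unfolding smooth_vec_on_def by blast
      then show ?thesis
        by (rule smooth_on_cong) (simp add: X rvec_append_def True)
    next
      case False
      \<comment> \<open>A constant, written as an affine function with coefficient 0.\<close>
      have "smooth_on (mfd_dim M) (\<phi> ` (U \<inter> V)) (\<lambda>x. \<eta> q (j - mfd_dim M) + 0 * x 0)"
        using cU(3) by (intro smooth_on_affine_coordinate) blast
      then show ?thesis
        by (rule smooth_on_cong) (simp add: X rvec_append_def False)
    qed
    then show ?thesis
      unfolding S smooth_vec_on_def by blast
  next
    case False
    then have "U \<inter> (\<lambda>p. (p, q)) -` X = {}"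
      unfolding X by auto
    \<comment> \<open>The slice misses this chart, so the domain is empty and smoothness is
      vacuous.\<close>
    then show ?thesis
      by (simp add: smooth_vec_on_def smooth_on_def)
  qed
qed

text \<open>
  In charts the first rows of the Jacobian of a slice are the Jacobian of a transition map of
  \<open>M\<close>, which the chain rule inverts, so the rank is the dimension of \<open>M\<close>.
\<close>

lemma constant_rank_slice:
  assumes M: "smooth_manifold M"
  shows "constant_rank M (prod_mfd M N) (\<lambda>p. (p, q))"
proof (rule constant_rankI)
  fix U \<phi> X \<theta> p assume U: "(U, \<phi>) \<in> mfd_charts M" and "(X, \<theta>) \<in> mfd_charts (prod_mfd M N)"
    and p: "p \<in> U \<inter> (\<lambda>p. (p, q)) -` X"
  then obtain V \<psi> W \<eta> where X: "X = V \<times> W" "\<theta> = (\<lambda>(p, q). rvec_append (mfd_dim M) (\<psi> p, \<eta> q))"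
      and V: "(V, \<psi>) \<in> mfd_charts M"
    by (elim prod_chartE)
  have atlas: "smooth_atlas M"
    using M unfolding smooth_manifold_def by blast
  note cU = manifold_chart[OF smooth_manifold_imp_with_boundary[OF M] U]
    and cV = manifold_chart[OF smooth_manifold_imp_with_boundary[OF M] V]
  have iU: "chart_into (mfd_top M) (Euclidean_space (mfd_dim M)) (U, \<phi>)"
    and iV: "chart_into (mfd_top M) (Euclidean_space (mfd_dim M)) (V, \<psi>)"
    using M U V unfolding smooth_manifold_def by blast+
  let ?m = "mfd_dim M" and ?n = "mfd_dim (prod_mfd M N)"
  let ?S = "\<phi> ` (U \<inter> V)" and ?T = "\<psi> ` (U \<inter> V)"
  let ?\<tau> = "\<psi> \<circ> inv_into U \<phi>" and ?\<sigma> = "\<phi> \<circ> inv_into V \<psi>"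
  let ?F = "\<theta> \<circ> (\<lambda>p. (p, q)) \<circ> inv_into U \<phi>" and ?x = "\<phi> p"
  \<comment> \<open>The point \<open>p\<close> witnesses that \<open>q\<close> lies in
    \<open>W\<close>, so the second factor imposes no further restriction on the domain.\<close>
  have S: "U \<inter> (\<lambda>p. (p, q)) -` X = U \<inter> V" and pUV: "p \<in> U \<inter> V"
    using p unfolding X by (auto split: if_splits)
  then have x: "?x \<in> ?S" by blast
  have UV: "openin (mfd_top M) (U \<inter> V)"
    using iU iV unfolding chart_into_def by auto
  \<comment> \<open>The charts of \<open>M\<close> map onto open subsets of the full space, so these
    domains are open there, whatever boundary \<open>N\<close> has.\<close>
  have S_open: "openin (Euclidean_space ?m) ?S" and T_open: "openin (Euclidean_space ?m) ?T"
    using chart_into_openin_image[OF iU UV] chart_into_openin_image[OF iV UV] by auto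
  define A where "A = jacobian ?m ?n ?S ?F ?x"
  \<comment> \<open>The Jacobian of the reverse transition map, padded with zero columns. These
    cancel the rows of \<open>A\<close> belonging to the coordinates of \<open>N\<close>, leaving a
    product of two square Jacobians.\<close>
  define B where "B = mat ?m ?n (\<lambda>(k, j). if j < ?m then partial_deriv ?T j (\<lambda>y. ?\<sigma> y k) (?\<tau> ?x) else 0)"
  have A: "A \<in> carrier_mat ?n ?m" and B: "B \<in> carrier_mat ?m ?n"
    by (simp_all add: A_def B_def jacobian_def)
  have entry: "A $$ (j, i) = partial_deriv ?S i (\<lambda>y. ?\<tau> y j) ?x" if "j < ?m" "i < ?m" for i j
  proof -
    have "A $$ (j, i) = partial_deriv ?S i (\<lambda>y. ?F y j) ?x"
      using that by (simp add: A_def jacobian_def)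
    also have "\<dots> = partial_deriv ?S i (\<lambda>y. ?\<tau> y j) ?x"
      by (rule partial_deriv_cong[OF x]) (simp add: X rvec_append_def that)
    finally show ?thesis .
  qed
  have "(B * A) $$ (k, i) = 1\<^sub>m ?m $$ (k, i)" if k: "k < ?m" and i: "i < ?m" for k i
  proof -
    have "(B * A) $$ (k, i) = (\<Sum>j<?n. B $$ (k, j) * A $$ (j, i))"
      using A B k i by (simp add: scalar_prod_def atLeast0LessThan)
    also have "\<dots> = (\<Sum>j<?m. B $$ (k, j) * A $$ (j, i))"
      using k by (intro sum.mono_neutral_right) (auto simp: B_def)
    also have "\<dots> = (\<Sum>j<?m. partial_deriv ?T j (\<lambda>y. ?\<sigma> y k) (?\<tau> ?x) * partial_deriv ?S i (\<lambda>y. ?\<tau> y j) ?x)"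
      using k i by (intro sum.cong) (auto simp: B_def entry)
    also have "\<dots> = (if i = k then 1 else 0)"
    proof (rule partial_derivs_left_inverse[OF S_open T_open _ _ _ _ x i])
      show "smooth_vec_on ?m ?m ?S ?\<tau>"
        by (rule smooth_atlas_transition[OF atlas U V])
      show "?\<tau> ` ?S \<subseteq> ?T"
        using cU(2) by auto
      show "smooth_on ?m ?T (\<lambda>y. ?\<sigma> y k)"
        using smooth_atlas_transition[OF atlas V U] k unfolding smooth_vec_on_def
        by (simp add: Int_commute)
      show "?\<sigma> (?\<tau> y) k = y k" if "y \<in> ?S" for y
        using that cU(2) cV(2) by auto
    qed
    finally show ?thesis
      using k i by simp
  qed
  then have "B * A = 1\<^sub>m ?m"
    using A B by (intro eq_matI) auto
  then show "vec_space.rank ?n (jacobian ?m ?n (\<phi> ` (U \<inter> (\<lambda>p. (p, q)) -` X)) ?F ?x) = ?m"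
    unfolding S A_def[symmetric] by (rule rank_left_invertible[OF A B])
qed

section \<open>The unit interval\<close>

text \<open>A common form of the two charts: \<open>(b, c) = (0, 1)\<close> gives \<open>t\<close>,
  and \<open>(b, c) = (1, -1)\<close> gives \<open>1 - t\<close>, so that each end of the interval
  is sent to the boundary point 0 by one of them. In both cases the chart domain is where the
  coordinate is less than 1.\<close>

definition interval_coord :: "real \<Rightarrow> real \<Rightarrow> real \<Rightarrow> rvec" where
  "interval_coord b c t = (\<lambda>i. if i = 0 then b + c * t else 0)"

lemma unit_interval_mfd_simps:
  "mfd_top unit_interval_mfd = top_of_set {0..1}"
  "mfd_dim unit_interval_mfd = 1"
  "mfd_charts unit_interval_mfd = {({0..<1}, interval_coord 0 1), ({0<..1}, interval_coord 1 (-1))}"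
  by (simp_all add: unit_interval_mfd_def interval_coord_def[abs_def] cong: if_cong)

lemma unit_interval_chartE:
  assumes "(U, \<phi>) \<in> mfd_charts unit_interval_mfd"
  obtains b c where "(b, c) \<in> {(0, 1), (1, -1 :: real)}" "U = {0..1} \<inter> {t. b + c * t < 1}" "\<phi> = interval_coord b c"
  using assms unfolding unit_interval_mfd_simps by fastforce

lemma interval_chart_into:
  assumes bc: "(b, c) \<in> {(0, 1), (1, -1 :: real)}"
  shows "chart_into (top_of_set {0..1}) (half_space 1) ({0..1} \<inter> {t. b + c * t < 1}, interval_coord b c)"
proof -
  let ?U = "{0..1} \<inter> {t. b + c * t < 1}" and ?\<phi> = "interval_coord b c"
  \<comment> \<open>Both \<open>t\<close> and \<open>1 - t\<close> are involutions of the unit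
    interval, so the inverse chart is given by the same formula.\<close>
  have invol: "b + c * (b + c * t) = t" and unit: "b + c * t \<in> {0..1} \<longleftrightarrow> t \<in> {0..1}" for t
    using bc by auto
  have coord: "continuous_map (half_space 1) euclideanreal (\<lambda>x. x 0)"
    unfolding half_space_def by (rule continuous_map_Euclidean_coordinate)
  have points: "topspace (half_space 1) = {x. (\<forall>i\<ge>1. x i = 0) \<and> 0 \<le> x 0}"
    by (auto simp: half_space_def topspace_Euclidean_space)
  \<comment> \<open>Written as a preimage under the coordinate function, the image is visibly open
    in the half line.\<close>
  have image: "?\<phi> ` ?U = {x \<in> topspace (half_space 1). x 0 \<in> {..<1}}"
  proof (intro equalityI subsetI)
    fix x assume "x \<in> ?\<phi> ` ?U"
    then show "x \<in> {x \<in> topspace (half_space 1). x 0 \<in> {..<1}}"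
      using bc unfolding points by (auto simp: interval_coord_def)
  next
    fix x assume x: "x \<in> {x \<in> topspace (half_space 1). x 0 \<in> {..<1}}"
    then have "x = ?\<phi> (b + c * x 0)"
      unfolding points by (auto simp: interval_coord_def fun_eq_iff invol)
    moreover have "b + c * x 0 \<in> ?U"
      using x unit[of "x 0"] unfolding points by (auto simp: invol)
    ultimately show "x \<in> ?\<phi> ` ?U"
      by blast
  qed
  have "openin (half_space 1) (?\<phi> ` ?U)"
    unfolding image by (rule openin_continuous_map_preimage[OF coord]) simp
  moreover have "openin (top_of_set {0..1}) ?U"
    by (intro openin_open_Int open_Collect_less continuous_intros)
  moreover have "homeomorphic_maps (subtopology (top_of_set {0..1}) ?U) (subtopology (half_space 1) (?\<phi> ` ?U))
      ?\<phi> (\<lambda>x. b + c * x 0)"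
    unfolding homeomorphic_maps_def
  proof (intro conjI ballI)
    have "continuous_map (top_of_set {0..1}) (powertop_real UNIV) ?\<phi>"
      unfolding continuous_map_componentwise_UNIV
    proof
      fix i
      have "(\<lambda>t. ?\<phi> t i) = (\<lambda>t. (if i = 0 then b else 0) + (if i = 0 then c else 0) * t)"
        by (auto simp: interval_coord_def)
      then show "continuous_map (top_of_set {0..1}) euclideanreal (\<lambda>t. ?\<phi> t i)"
        by (simp only: continuous_map_iff_continuous) (intro continuous_intros)
    qed
    then have "continuous_map (subtopology (top_of_set {0..1}) ?U) (powertop_real UNIV) ?\<phi>"
      by (rule continuous_map_from_subtopology)
    then have "continuous_map (subtopology (top_of_set {0..1}) ?U) (half_space 1) ?\<phi>"
      unfolding half_space_def Euclidean_space_def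
      by (intro continuous_map_into_subtopology) (use bc in \<open>auto simp: interval_coord_def\<close>)
    then show "continuous_map (subtopology (top_of_set {0..1}) ?U) (subtopology (half_space 1) (?\<phi> ` ?U)) ?\<phi>"
      by (rule continuous_map_into_subtopology) auto
    have "continuous_map (subtopology (half_space 1) (?\<phi> ` ?U)) euclideanreal (\<lambda>x. b + c * x 0)"
      by (intro continuous_map_from_subtopology continuous_map_add continuous_map_real_mult coord) auto
    then show "continuous_map (subtopology (half_space 1) (?\<phi> ` ?U)) (subtopology (top_of_set {0..1}) ?U)
        (\<lambda>x. b + c * x 0)"
      unfolding subtopology_subtopology
      by (rule continuous_map_into_subtopology) (auto simp: interval_coord_def invol)
  qed (auto simp: interval_coord_def invol)
  ultimately show ?thesis
    unfolding chart_into_def split using homeomorphic_maps_imp_map by blast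
qed

lemma smooth_manifold_with_boundary_unit_interval:
  "smooth_manifold_with_boundary unit_interval_mfd"
  unfolding smooth_manifold_with_boundary_def
proof (intro conjI ballI)
  show "Hausdorff_space (mfd_top unit_interval_mfd)"
    unfolding unit_interval_mfd_simps by (intro Hausdorff_space_subtopology Hausdorff_space_euclidean)
  show "second_countable (mfd_top unit_interval_mfd)"
    unfolding unit_interval_mfd_simps by (intro second_countable_subtopology second_countable_euclidean)
  show "smooth_atlas unit_interval_mfd"
  proof (rule smooth_atlasI)
    show "(\<Union>c\<in>mfd_charts unit_interval_mfd. fst c) = mfd_points unit_interval_mfd"
      by (auto simp: unit_interval_mfd_simps)
    fix U \<phi> V \<psi> assume "(U, \<phi>) \<in> mfd_charts unit_interval_mfd" "(V, \<psi>) \<in> mfd_charts unit_interval_mfd"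
    then obtain b c b' c' where bc: "(b, c) \<in> {(0, 1), (1, -1 :: real)}"
        and \<phi>: "\<phi> = interval_coord b c" and \<psi>: "\<psi> = interval_coord b' c'"
      by (elim unit_interval_chartE)
    have inv: "inv_into U \<phi> (\<phi> t) = t" if "t \<in> U" for t
      using that bc by (intro inv_into_f_f) (auto simp: inj_on_def \<phi> interval_coord_def fun_eq_iff)
    have "smooth_on 1 (\<phi> ` (U \<inter> V)) (\<lambda>x. (\<psi> \<circ> inv_into U \<phi>) x 0)"
    proof (rule smooth_on_cong)
      \<comment> \<open>The first chart is inverted by \<open>b + c * x 0\<close>; substituting this
        for \<open>t\<close> in \<open>b' + c' * t\<close> gives the affine function below.\<close>
      show "smooth_on 1 (\<phi> ` (U \<inter> V)) (\<lambda>x. (b' + c' * b) + (c' * c) * x 0)"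
        by (rule smooth_on_affine_coordinate) (auto simp: \<phi> interval_coord_def topspace_Euclidean_space)
      fix x assume "x \<in> \<phi> ` (U \<inter> V)"
      then obtain t where "x = \<phi> t" "t \<in> U"
        by blast
      then show "(b' + c' * b) + (c' * c) * x 0 = (\<psi> \<circ> inv_into U \<phi>) x 0"
        using bc inv by (auto simp: \<phi> \<psi> interval_coord_def algebra_simps)
    qed
    then show "smooth_vec_on (mfd_dim unit_interval_mfd) (mfd_dim unit_interval_mfd) (\<phi> ` (U \<inter> V)) (\<psi> \<circ> inv_into U \<phi>)"
      unfolding smooth_vec_on_def unit_interval_mfd_simps by simp
  qed
  fix c assume "c \<in> mfd_charts unit_interval_mfd"
  then show "chart_into (mfd_top unit_interval_mfd) (Euclidean_space (mfd_dim unit_interval_mfd)) c \<or>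
      chart_into (mfd_top unit_interval_mfd) (half_space (mfd_dim unit_interval_mfd)) c"
    by (cases c) (auto elim!: unit_interval_chartE simp: unit_interval_mfd_simps(1,2) simp del: One_nat_def intro: interval_chart_into)
qed

section \<open>Homotopic maps\<close>

theorem proposition11:
  fixes M :: "'a mfd" and N :: "'b mfd"
    and u\<^sub>1 u\<^sub>2 :: "'a \<Rightarrow> 'b" and h :: "'a \<times> real \<Rightarrow> 'b"
  assumes "smooth_manifold M" and "smooth_manifold N"
    and "smooth_map M N u\<^sub>1" and "smooth_map M N u\<^sub>2"
    and "smooth_homotopy M N h u\<^sub>1 u\<^sub>2"
  shows "constant_rank_signature_equivalent M M N u\<^sub>1 u\<^sub>2"
proof -
  let ?P = "prod_mfd M unit_interval_mfd"
  have P: "smooth_manifold_with_boundary ?P"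
    by (rule smooth_manifold_with_boundary_prod[OF assms(1) smooth_manifold_with_boundary_unit_interval])
      (simp add: unit_interval_mfd_simps)
  then obtain e :: "'a \<times> real \<Rightarrow> rvec" where e: "inj_on e (mfd_points ?P)"
    using second_countable_Hausdorff_inj_rvec unfolding smooth_manifold_with_boundary_def by metis
  let ?C = "transport_mfd e ?P" and ?U = "h \<circ> inv_into (mfd_points ?P) e"
  have atlas: "smooth_atlas M"
    using assms(1) unfolding smooth_manifold_def by blast
  \<comment> \<open>Every time \<open>t\<close> gives an inclusion of constant rank, so one argument
    serves both ends.\<close>
  have slice: "smooth_map M ?C (e \<circ> (\<lambda>p. (p, t)))" "constant_rank M ?C (e \<circ> (\<lambda>p. (p, t)))"
    if "t \<in> {0..1}" for t
  proof -
    have "t \<in> mfd_points unit_interval_mfd"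
      using that by (simp add: unit_interval_mfd_simps)
    note t = smooth_map_slice[OF assms(1) this]
    show "smooth_map M ?C (e \<circ> (\<lambda>p. (p, t)))"
      by (rule smooth_map_into_transport[OF e P atlas t])
    show "constant_rank M ?C (e \<circ> (\<lambda>p. (p, t)))"
      by (rule constant_rank_into_transport[OF e P atlas t constant_rank_slice[OF assms(1)]])
  qed
  have h: "smooth_map ?P N h" "\<forall>p\<in>mfd_points M. h (p, 0) = u\<^sub>1 p \<and> h (p, 1) = u\<^sub>2 p"
    using assms(5) unfolding smooth_homotopy_def by blast+
  \<comment> \<open>The map \<open>?U\<close> first undoes \<open>e\<close> and then applies
    \<open>h\<close>. At \<open>t = 0\<close> and \<open>t = 1\<close> this is the required
    factorisation of \<open>u\<^sub>1\<close> and \<open>u\<^sub>2\<close>.\<close>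
  have "?U ((e \<circ> (\<lambda>p. (p, t))) p) = h (p, t)" if "p \<in> mfd_points M" "t \<in> {0..1}" for p t
    using that e by (simp add: inv_into_f_f unit_interval_mfd_simps)
  then show ?thesis
    unfolding constant_rank_signature_equivalent_def
    using h(2) slice smooth_manifold_with_boundary_transport[OF e P] smooth_map_from_transport[OF e P h(1)]
    by (intro exI[of _ ?C] exI[of _ ?U] exI[of _ "e \<circ> (\<lambda>p. (p, 0))"] exI[of _ "e \<circ> (\<lambda>p. (p, 1))"]) simp
qed

end
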